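(* Under the standing setting and assumptions (A0)–(A3) below, $\mathbb E[d^2(x_n,x^* )]\to0$ and $d^2(x_n,x^* )\to0$ almost surely. Moreover, let $\chi:(0,\infty)\to\mathbb N$ and $\theta:\mathbb N\times(0,\infty)\to\mathbb N$ satisfy $\sum_{n=\chi(\varepsilon)}^\infty\lambda_n^2<\varepsilon$ for all $\varepsilon>0$ and $\sum_{n=k}^{\theta(k,b')}\lambda_n\geq b'$ for all $b'>0$, $k\in\mathbb N$; let $\Lambda>\sum_{n=0}^\infty\lambda_n^2$, $c>0$ with $c>\int\|\phi^*\|^2_{x^*}\,d\mu$, and $b>0$ with $b>\mathbb E[d^2(x_0,x^* )]$. Put $C:=4(b+2\Lambda c)+\Lambda c$, $D:=e^{2\Lambda}(b+C)/(2\underline\alpha)$ and $\rho(\varepsilon):=\theta\big(\chi(\varepsilon/(2c)),2D/\varepsilon\big)$. Then \[ \forall\varepsilon>0\ \forall n\geq\rho(\varepsilon):\ \mathbb E[d^2(x_n,x^* )]<\varepsilon, \] and, with $\rho'(\lambda,\varepsilon):=\rho(\lambda\varepsilon)$, \[ \forall\lambda,\varepsilon>0:\ \mathbb P\big(\exists n\geq\rho'(\lambda,\varepsilon)\ \ d^2(x_n,x^* )\geq\varepsilon\big)<\lambda. \]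
   Context: Geometry. A Hadamard space is a complete CAT(0) space: a geodesic metric space $(X,d)$ with $d^2(\gamma(tl),x)\leq (1-t)d^2(\gamma(0),x)+td^2(\gamma(l),x)-t(1-t)d^2(\gamma(0),\gamma(l))$ for all $x\in X$, geodesics $\gamma:[0,l]\to X$, $t\in[0,1]$; it is uniquely geodesic, $\gamma_{x,y}$ denoting the geodesic from $x$ to $y$. For $x\in X$, $\angle_x(\gamma,\eta):=\lim_{s,t\to0^+}\bar\angle_x(\gamma(s),\eta(t))$ is the Aleksandrov angle between nonconstant geodesics issuing from $x$; $\Sigma_xX$ is the completion of such geodesics modulo $\angle_x=0$; the tangent space $T_xX$ is the Euclidean cone over $\Sigma_xX$ (elements $t\gamma$, $t\ge0$, all $0\gamma$ identified to $0_x$, $\lambda(t\gamma):=(\lambda t)\gamma$), with metric $d_x(t\gamma,s\eta)=\sqrt{t^2+s^2-2ts\cos\angle_x(\gamma,\eta)}$, $\|t\gamma\|_x=t$, $g_x(t\gamma,s\eta)=ts\cos\angle_x(\gamma,\eta)$; $TX=\bigcup_xT_xX$. $\log_x:X\to T_xX$, $\log_xa:=d(x,a)\gamma_{x,a}$ ($a\ne x$), $\log_xx:=0_x$. Vector fields. $A:X\to2^{TX}$ with $A(x)\subseteq T_xX$ is monotone if $g_x(u,\log_xy)\le-g_y(v,\log_yx)$ for all $u\in A(x),v\in A(y)$, and strongly monotone with modulus $\alpha>0$ if $g_x(u,\log_xy)\le-g_y(v,\log_yx)-\alpha d^2(x,y)$. For monotone $A$ and $\lambda>0$, the resolvent $J_\lambda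 x$ is the unique $z$ with $\tfrac1\lambda\log_zx\in A(z)$ (if it exists); $A$ satisfies the surjectivity condition if such $z$ exists for all $\lambda>0,x\in X$. The Yosida approximate is $A_\lambda x:=\tfrac1\lambda\log_{J_\lambda x}x\in T_{J_\lambda x}X$. Integration. For a probability space and a separable Hadamard space $Y$, $L^p$ consists of measurable $Y$-valued maps with finite $p$-th moment of distance; the integral/expectation of an $L^1$ map is the barycenter of its distribution (minimizer of $z\mapsto\int(d^2(z,w)-d^2(w,y))$), and conditional expectation $\mathbb E[x\mid\mathcal G]$ of $x\in L^2$ is the $\mathcal G$-measurable $L^2$ map minimizing $\int d^2(z,x)$ (extended continuously to $L^1$); this applies to $Y=X$ and $Y=T_xX$. Standing setting. $(E,\mathcal E,\mu)$ and $(\Omega,\mathcal F,\mathbb P)$ are probability spaces; $X$ is a separable Hadamard space with every $T_xX$ separable. $A:E\times X\to2^{TX}$, $A(s,x)\subseteq T_xX$, is a random monotone vector field: each $A(s,\cdot)$ is monotone and $s\mapsto J_\lambda(s,x)$ is $\mathcal E/\mathcal B(X)$-measurable for every $x,\lambda$, where $J_\lambda(s,\cdot)$, $A_\lambda(s,\cdot)$ denote resolvent and Yosida approximate of $A(s,\cdot)$; moreover each $A(s,\cdot)$ satisfies the surjectivity condition. For $x\in X$, $S^p_A(x)$ is the set of measurable $\phi:E\to T_xX$ with $\phi(s)\in A(s,x)$ for all $s$ and $\phi\in L^p(E,T_xX,\mu)$; the mean field is $\underline A(x):=\{\int\phi\,d\mu\mid\phi\in S^1_A(x)\}$; $\mathcal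 Z_A(2):=\{x\mid\exists\phi\in S^2_A(x),\ \int\phi\,d\mu=0_x\}$. Given $x_0\in X$, $(\lambda_n)\subseteq(0,\infty)$ and random variables $\xi_n:\Omega\to E$, the iteration is $x_{n+1}:=J_{\lambda_n}(\xi_{n+1},x_n)$; $\mathcal F_n:=\sigma(\xi_1,\dots,\xi_n)$ ($\mathcal F_0$ trivial), $\mathbb E_n[\cdot]:=\mathbb E[\cdot\mid\mathcal F_n]$. Note $\|A_{\lambda_n}(\xi_{n+1},x_n)\|_{x_{n+1}}=d(x_n,x_{n+1})/\lambda_n$. Assumptions. (A0) $\sum_n\lambda_n^2<\infty$, $\sum_n\lambda_n=\infty$, and $(\xi_{n+1})$ is i.i.d. with distribution $\mu$. (A1) each $A(s,\cdot)$ is strongly monotone with modulus $\alpha(s)\in(0,1]$, where $\alpha:E\to(0,1]$ is measurable with $\underline\alpha:=\int\alpha\,d\mu>0$. (A2) $\underline A$ has a zero $x^*$ (i.e. $0_{x^*}\in\underline A(x^* )$) with $x^*\in\mathcal Z_A(2)$; a fixed $\phi^*\in S^2_A(x^* )$ with $\int\phi^*\,d\mu=0_{x^*}$ is chosen. (A3) $\mathbb E_n[g_{x^*}(\phi^*(\xi_{n+1}),\log_{x^*}x_n)]=0$ a.s. for every $n\in\mathbb N$. *)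

theory Defs
  imports "HOL-Probability.Probability"
begin

definition cat0_geodesic :: "(real \<Rightarrow> 'a::metric_space) \<Rightarrow> real \<Rightarrow> bool" where
  "cat0_geodesic \<gamma> l \<longleftrightarrow> 0 \<le> l \<and> (\<forall>s\<in>{0..l}. \<forall>t\<in>{0..l}. dist (\<gamma> s) (\<gamma> t) = \<bar>s - t\<bar>)"

text \<open>Completeness and separability come from the class polish_space;
  this predicate adds: geodesic, and the CAT(0) inequality.\<close>
definition hadamard_space :: "'a::polish_space itself \<Rightarrow> bool" where
  "hadamard_space _ \<longleftrightarrow>
     (\<forall>x y::'a. \<exists>\<gamma>. cat0_geodesic \<gamma> (dist x y) \<and> \<gamma> 0 = x \<and> \<gamma> (dist x y) = y) \<and>
     (\<forall>(\<gamma>::real \<Rightarrow> 'a) l (x::'a) t. cat0_geodesic \<gamma> l \<longrightarrow> t \<in> {0..1} \<longrightarrow>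
        (dist (\<gamma> (t * l)) x)^2 \<le> (1 - t) * (dist (\<gamma> 0) x)^2 + t * (dist (\<gamma> l) x)^2
                                   - t * (1 - t) * (dist (\<gamma> 0) (\<gamma> l))^2)"

definition geod :: "'a::metric_space \<Rightarrow> 'a \<Rightarrow> real \<Rightarrow> 'a" where
  "geod x y = (SOME \<gamma>. cat0_geodesic \<gamma> (dist x y) \<and> \<gamma> 0 = x \<and> \<gamma> (dist x y) = y)"

definition cmp_angle :: "'a::metric_space \<Rightarrow> 'a \<Rightarrow> 'a \<Rightarrow> real" where
  "cmp_angle x p q = arccos (((dist x p)^2 + (dist x q)^2 - (dist p q)^2) / (2 * dist x p * dist x q))"

text \<open>Aleksandrov angle at x between the geodesics gamma_{x,y} and gamma_{x,z} (y, z distinct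
  from x). Every nonconstant geodesic issuing from x is (a reparametrisation-free restriction of)
  gamma_{x,y} for y its endpoint, so geodesics from x are represented by their endpoints.\<close>
definition alex_angle :: "'a::metric_space \<Rightarrow> 'a \<Rightarrow> 'a \<Rightarrow> real" where
  "alex_angle x y z =
     Lim (at (0,0) within ({0<..} \<times> {0<..})) (\<lambda>(s,t). cmp_angle x (geod x y s) (geod x z t))"

text \<open>Cauchy sequences of directions at x (for the angle pseudometric); their classes form
  the completion Sigma_x X.\<close>
definition dir_seq :: "'a::metric_space \<Rightarrow> (nat \<Rightarrow> 'a) \<Rightarrow> bool" where
  "dir_seq x \<sigma> \<longleftrightarrow> (\<forall>n. \<sigma> n \<noteq> x) \<and>
     (\<forall>e>0. \<exists>N. \<forall>m\<ge>N. \<forall>n\<ge>N. alex_angle x (\<sigma> m) (\<sigma> n) < e)"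

definition dir_angle :: "'a::metric_space \<Rightarrow> (nat \<Rightarrow> 'a) \<Rightarrow> (nat \<Rightarrow> 'a) \<Rightarrow> real" where
  "dir_angle x \<sigma> \<tau> = lim (\<lambda>n. alex_angle x (\<sigma> n) (\<tau> n))"

text \<open>Representatives of tangent vectors: (base point, length t, direction).\<close>
type_synonym 'a trep = "'a \<times> real \<times> (nat \<Rightarrow> 'a)"
type_synonym 'a tvec = "'a trep set"

definition tvalid :: "'a::metric_space trep \<Rightarrow> bool" where
  "tvalid r \<longleftrightarrow> (case r of (x, t, \<sigma>) \<Rightarrow> 0 \<le> t \<and> (t = 0 \<or> dir_seq x \<sigma>))"

text \<open>Euclidean cone metric on representatives with the same base point.\<close>
definition rdist :: "'a::metric_space trep \<Rightarrow> 'a trep \<Rightarrow> real" where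
  "rdist r r' = (case r of (x, t, \<sigma>) \<Rightarrow> case r' of (_, s, \<tau>) \<Rightarrow>
      sqrt (t^2 + s^2 - 2 * t * s * cos (dir_angle x \<sigma> \<tau>)))"

definition tclass :: "'a::metric_space trep \<Rightarrow> 'a tvec" where
  "tclass r = {r'. tvalid r' \<and> fst r' = fst r \<and> rdist r r' = 0}"

definition tangent_space :: "'a::metric_space \<Rightarrow> 'a tvec set" where
  "tangent_space x = {tclass r | r. tvalid r \<and> fst r = x}"

definition trep_of :: "'a tvec \<Rightarrow> 'a trep" where
  "trep_of u = (SOME r. r \<in> u)"

definition tdist :: "'a::metric_space tvec \<Rightarrow> 'a tvec \<Rightarrow> real" where
  "tdist u v = rdist (trep_of u) (trep_of v)"

definition tnorm :: "'a::metric_space tvec \<Rightarrow> real" where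
  "tnorm u = fst (snd (trep_of u))"

definition tg :: "'a::metric_space tvec \<Rightarrow> 'a tvec \<Rightarrow> real" where
  "tg u v = (case trep_of u of (x, t, \<sigma>) \<Rightarrow> case trep_of v of (_, s, \<tau>) \<Rightarrow>
      t * s * cos (dir_angle x \<sigma> \<tau>))"

definition tzero :: "'a::metric_space \<Rightarrow> 'a tvec" where
  "tzero x = tclass (x, 0, \<lambda>_. x)"

definition tscale :: "real \<Rightarrow> 'a::metric_space tvec \<Rightarrow> 'a tvec" where
  "tscale c u = (case trep_of u of (x, t, \<sigma>) \<Rightarrow> tclass (x, c * t, \<sigma>))"

definition tlog :: "'a::metric_space \<Rightarrow> 'a \<Rightarrow> 'a tvec" where
  "tlog x a = (if a = x then tzero x else tclass (x, dist x a, \<lambda>_. a))"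

definition t_open :: "'a::metric_space \<Rightarrow> 'a tvec set \<Rightarrow> bool" where
  "t_open x U \<longleftrightarrow> U \<subseteq> tangent_space x \<and>
     (\<forall>u\<in>U. \<exists>e>0. {v\<in>tangent_space x. tdist u v < e} \<subseteq> U)"

definition tborel :: "'a::metric_space \<Rightarrow> 'a tvec measure" where
  "tborel x = sigma (tangent_space x) {U. t_open x U}"

definition tangent_separable :: "'a::metric_space \<Rightarrow> bool" where
  "tangent_separable x \<longleftrightarrow> (\<exists>D. countable D \<and> D \<subseteq> tangent_space x \<and>
     (\<forall>u\<in>tangent_space x. \<forall>e>0. \<exists>v\<in>D. tdist u v < e))"

definition vector_field :: "('a::metric_space \<Rightarrow> 'a tvec set) \<Rightarrow> bool" where
  "vector_field B \<longleftrightarrow> (\<forall>x. B x \<subseteq> tangent_space x)"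

definition monotone_vf :: "('a::metric_space \<Rightarrow> 'a tvec set) \<Rightarrow> bool" where
  "monotone_vf B \<longleftrightarrow> (\<forall>x y. \<forall>u\<in>B x. \<forall>v\<in>B y. tg u (tlog x y) \<le> - tg v (tlog y x))"

definition strongly_monotone_vf :: "('a::metric_space \<Rightarrow> 'a tvec set) \<Rightarrow> real \<Rightarrow> bool" where
  "strongly_monotone_vf B \<alpha> \<longleftrightarrow> \<alpha> > 0 \<and>
     (\<forall>x y. \<forall>u\<in>B x. \<forall>v\<in>B y. tg u (tlog x y) \<le> - tg v (tlog y x) - \<alpha> * (dist x y)^2)"

definition resolvent :: "('a::metric_space \<Rightarrow> 'a tvec set) \<Rightarrow> real \<Rightarrow> 'a \<Rightarrow> 'a" where
  "resolvent B lam x = (THE z. tscale (1 / lam) (tlog z x) \<in> B z)"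

definition surjectivity_cond :: "('a::metric_space \<Rightarrow> 'a tvec set) \<Rightarrow> bool" where
  "surjectivity_cond B \<longleftrightarrow> (\<forall>lam>0. \<forall>x. \<exists>z. tscale (1 / lam) (tlog z x) \<in> B z)"

definition random_monotone_vf :: "'e measure \<Rightarrow> ('e \<Rightarrow> 'a::metric_space \<Rightarrow> 'a tvec set) \<Rightarrow> bool" where
  "random_monotone_vf \<mu> A \<longleftrightarrow>
     (\<forall>s\<in>space \<mu>. vector_field (A s) \<and> monotone_vf (A s) \<and> surjectivity_cond (A s)) \<and>
     (\<forall>x lam. lam > 0 \<longrightarrow> (\<lambda>s. resolvent (A s) lam x) \<in> measurable \<mu> borel)"

definition selections :: "'e measure \<Rightarrow> ('e \<Rightarrow> 'a::metric_space \<Rightarrow> 'a tvec set) \<Rightarrow> real \<Rightarrow> 'a \<Rightarrow> ('e \<Rightarrow> 'a tvec) set" where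
  "selections \<mu> A p x = {\<phi>. \<phi> \<in> measurable \<mu> (tborel x) \<and> (\<forall>s\<in>space \<mu>. \<phi> s \<in> A s x) \<and>
      (\<integral>\<^sup>+ s. ennreal ((tnorm (\<phi> s)) powr p) \<partial>\<mu>) < \<infinity>}"

text \<open>b is the barycentre (integral) of phi: it minimises
  z |-> int (d^2(z, phi s) - d^2(phi s, y)), with reference point y = 0_x.\<close>
definition is_tbarycenter :: "'e measure \<Rightarrow> 'a::metric_space \<Rightarrow> ('e \<Rightarrow> 'a tvec) \<Rightarrow> 'a tvec \<Rightarrow> bool" where
  "is_tbarycenter \<mu> x \<phi> b \<longleftrightarrow> b \<in> tangent_space x \<and>
     (\<forall>z\<in>tangent_space x.
        (\<integral>s. (tdist b (\<phi> s))^2 - (tdist (\<phi> s) (tzero x))^2 \<partial>\<mu>)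
          \<le> (\<integral>s. (tdist z (\<phi> s))^2 - (tdist (\<phi> s) (tzero x))^2 \<partial>\<mu>))"

definition mean_field :: "'e measure \<Rightarrow> ('e \<Rightarrow> 'a::metric_space \<Rightarrow> 'a tvec set) \<Rightarrow> 'a \<Rightarrow> 'a tvec set" where
  "mean_field \<mu> A x = {b. \<exists>\<phi>\<in>selections \<mu> A 1 x. is_tbarycenter \<mu> x \<phi> b}"

definition zeros_A2 :: "'e measure \<Rightarrow> ('e \<Rightarrow> 'a::metric_space \<Rightarrow> 'a tvec set) \<Rightarrow> 'a set" where
  "zeros_A2 \<mu> A = {x. \<exists>\<phi>\<in>selections \<mu> A 2 x. is_tbarycenter \<mu> x \<phi> (tzero x)}"

primrec ppa_iter :: "('e \<Rightarrow> 'a::metric_space \<Rightarrow> 'a tvec set) \<Rightarrow> (nat \<Rightarrow> real) \<Rightarrow> (nat \<Rightarrow> 'w \<Rightarrow> 'e)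
     \<Rightarrow> 'a \<Rightarrow> nat \<Rightarrow> 'w \<Rightarrow> 'a" where
  "ppa_iter A lam \<xi> x0 0 \<omega> = x0"
| "ppa_iter A lam \<xi> x0 (Suc n) \<omega> = resolvent (A (\<xi> (Suc n) \<omega>)) (lam n) (ppa_iter A lam \<xi> x0 n \<omega>)"

definition filtr :: "'w measure \<Rightarrow> 'e measure \<Rightarrow> (nat \<Rightarrow> 'w \<Rightarrow> 'e) \<Rightarrow> nat \<Rightarrow> 'w measure" where
  "filtr P \<mu> \<xi> n = sigma (space P) (\<Union>i\<in>{1..n}. {\<xi> i -` B \<inter> space P | B. B \<in> sets \<mu>})"

end

(*
Let z = J_l x, let p be the zero and phi in A(p). Strong monotonicity and the law of cosines
inequality g_z(log x, log p) >= (d(z,x)^2 + d(z,p)^2 - d(x,p)^2) / 2 give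
  (1 + 2 l a) d(z,p)^2 + d(z,x)^2 <= d(x,p)^2 - 2 l g_p(phi, log z).
Since v |-> g_p(phi, v) is |phi|-Lipschitz, log z may be replaced by log x at the cost
2 l |phi| d(z,x), which the term d(z,x)^2 absorbs up to O(l^2). The remaining linear term has
conditional mean zero by (A3). Hence d(x_n,p)^2 plus c0 times the tail of the series of l_n^2,
where c0 is the second moment of phi, is a supermartingale; the weighted sum of the
l_n E d(x_n,p)^2 is bounded because xi_{n+1} is independent of x_n; and Ville's inequality turns the
bound in expectation into the almost sure one.
*)
theory Submission
  imports Defs
begin

section \<open>Alexandrov angles in Hadamard spaces\<close>

text \<open>Angles, directions and tangent vectors are given through \<open>Lim\<close>,
  \<open>lim\<close> and \<open>SOME\<close>, so nothing can be computed with them before the limits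
  exist and representatives are interchangeable. Monotonicity of comparison angles settles the first
  limit. A Lipschitz estimate for cosines of angles settles the rest, and the same estimate gives
  the Lipschitz bound on the pairing used in the descent step.

  In the descent step the modulus multiplies the distance of the new point, which depends on the
  same sample, so the expectation does not factor. Returning to the old distance costs a term of
  order l^2 that contains d(x,p)^2 itself. The squared distances must therefore first be bounded
  uniformly by the plain descent before the weighted sum can be controlled.

  From \<open>\<rho> \<epsilon>\<close> on, not only the mean of d(x_n,p)^2 but its sum with the
  tail correction is below \<epsilon>. That sum is the initial mean in the maximal inequality, so
  evaluating the rate at \<open>l * \<epsilon>\<close> gives the almost sure rate.\<close>

definition cmp_cos :: "'a::metric_space \<Rightarrow> 'a \<Rightarrow> 'a \<Rightarrow> real" where
  "cmp_cos x p q = ((dist x p)^2 + (dist x q)^2 - (dist p q)^2) / (2 * dist x p * dist x q)"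

lemma cmp_angle_eq: "cmp_angle x p q = arccos (cmp_cos x p q)"
  by (simp add: cmp_angle_def cmp_cos_def)

lemma cmp_cos_commute: "cmp_cos x p q = cmp_cos x q p"
  by (simp add: cmp_cos_def dist_commute mult_ac add_ac)

lemma cmp_cos_bounds:
  fixes x p q :: "'a::metric_space"
  assumes "p \<noteq> x" "q \<noteq> x"
  shows "-1 \<le> cmp_cos x p q" "cmp_cos x p q \<le> 1"
proof -
  have pos: "dist x p > 0" "dist x q > 0" using assms by auto
  then have pos2: "2 * dist x p * dist x q > 0" by simp
  have "(dist p q)^2 \<le> (dist x p + dist x q)^2"
    by (rule power_mono) (metis dist_commute dist_triangle, simp)
  then have "- (2 * dist x p * dist x q) \<le> (dist x p)^2 + (dist x q)^2 - (dist p q)^2"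
    by (simp add: power2_sum)
  then show "-1 \<le> cmp_cos x p q"
    unfolding cmp_cos_def using pos2 by (simp add: pos_le_divide_eq)
  have "\<bar>dist x p - dist x q\<bar> \<le> dist p q"
    by (metis abs_dist_diff_le dist_commute)
  then have "(dist x p - dist x q)^2 \<le> (dist p q)^2"
    by (metis abs_ge_zero power2_abs power_mono)
  then have "(dist x p)^2 + (dist x q)^2 - (dist p q)^2 \<le> 2 * dist x p * dist x q"
    by (simp add: power2_diff)
  then show "cmp_cos x p q \<le> 1"
    unfolding cmp_cos_def using pos2 by (simp add: pos_divide_le_eq)
qed

lemma geod_geodesic:
  fixes x y :: "'a::polish_space"
  assumes "hadamard_space TYPE('a)"
  shows "cat0_geodesic (geod x y) (dist x y)" "geod x y 0 = x" "geod x y (dist x y) = y"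
proof -
  have "\<exists>\<gamma>. cat0_geodesic \<gamma> (dist x y) \<and> \<gamma> 0 = x \<and> \<gamma> (dist x y) = y"
    using assms unfolding hadamard_space_def by blast
  from someI_ex[OF this]
  show "cat0_geodesic (geod x y) (dist x y)" "geod x y 0 = x" "geod x y (dist x y) = y"
    unfolding geod_def by auto
qed

lemma dist_geod:
  fixes x y :: "'a::polish_space"
  assumes "hadamard_space TYPE('a)" "0 \<le> s" "s \<le> dist x y"
  shows "dist x (geod x y s) = s"
proof -
  have "dist (geod x y 0) (geod x y s) = \<bar>0 - s\<bar>"
    using geod_geodesic(1)[OF assms(1)] assms(2,3) unfolding cat0_geodesic_def by auto
  then show ?thesis using geod_geodesic(2)[OF assms(1)] assms(2) by simp
qed

lemma geod_ne:
  fixes x y :: "'a::polish_space"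
  assumes "hadamard_space TYPE('a)" "0 < s" "s \<le> dist x y"
  shows "geod x y s \<noteq> x"
  using dist_geod[of s x y] assms by auto

text \<open>The CAT(0) inequality on the initial segment of length s', at parameter s / s', says
  after cancellation that comparison angles shrink as a point slides towards the vertex.\<close>

lemma cmp_cos_geod_antimono:
  fixes x y q :: "'a::polish_space"
  assumes H: "hadamard_space TYPE('a)" and s: "0 < s" "s \<le> s'" "s' \<le> dist x y" and q: "q \<noteq> x"
  shows "cmp_cos x (geod x y s') q \<le> cmp_cos x (geod x y s) q"
proof -
  define r where "r = s / s'"
  have r: "0 < r" "r \<le> 1" "r * s' = s" using s by (auto simp: r_def)
  have rs: "s = r * s'" using r(3) by simp
  have g: "cat0_geodesic (geod x y) s'"
    using geod_geodesic(1)[OF H, of x y] s unfolding cat0_geodesic_def by auto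
  have "(dist (geod x y (r * s')) q)^2 \<le> (1 - r) * (dist (geod x y 0) q)^2
      + r * (dist (geod x y s') q)^2 - r * (1 - r) * (dist (geod x y 0) (geod x y s'))^2"
    using H g r unfolding hadamard_space_def by auto
  then have "(dist (geod x y s) q)^2 \<le> (1 - r) * (dist x q)^2
      + r * (dist (geod x y s') q)^2 - r * (1 - r) * s'^2"
    using s r(3) by (simp add: geod_geodesic(2)[OF H] dist_geod[OF H])
  moreover have "s^2 = r^2 * s'^2" using r(3) by (metis power_mult_distrib)
  ultimately have *: "r * (s'^2 + (dist x q)^2 - (dist (geod x y s') q)^2)
      \<le> s^2 + (dist x q)^2 - (dist (geod x y s) q)^2"
    by (simp add: algebra_simps power2_eq_square)
  have "cmp_cos x (geod x y s') q
      = r * (s'^2 + (dist x q)^2 - (dist (geod x y s') q)^2) / (2 * s * dist x q)"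
    using s r(1) by (simp add: cmp_cos_def dist_geod[OF H] rs)
  also have "\<dots> \<le> (s^2 + (dist x q)^2 - (dist (geod x y s) q)^2) / (2 * s * dist x q)"
    using * s q by (intro divide_right_mono) auto
  also have "\<dots> = cmp_cos x (geod x y s) q"
    using s by (simp add: cmp_cos_def dist_geod[OF H])
  finally show ?thesis .
qed

text \<open>The limit is the supremum: a value close to it, attained at some point, is exceeded at
  all points nearer to the corner. This yields the joint limit in two variables that
  \<open>alex_angle\<close> asks for, and bounds it below by the value at the far end.\<close>

lemma antimono_tendsto_corner:
  fixes f :: "real \<Rightarrow> real \<Rightarrow> real"
  assumes d: "0 < d1" "0 < d2"
    and f1: "\<And>s s' t. 0 < s \<Longrightarrow> s \<le> s' \<Longrightarrow> s' \<le> d1 \<Longrightarrow> 0 < t \<Longrightarrow> t \<le> d2 \<Longrightarrow> f s' t \<le> f s t"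
    and f2: "\<And>s t t'. 0 < s \<Longrightarrow> s \<le> d1 \<Longrightarrow> 0 < t \<Longrightarrow> t \<le> t' \<Longrightarrow> t' \<le> d2 \<Longrightarrow> f s t' \<le> f s t"
    and bd: "\<And>s t. 0 < s \<Longrightarrow> s \<le> d1 \<Longrightarrow> 0 < t \<Longrightarrow> t \<le> d2 \<Longrightarrow> f s t \<le> B"
  obtains L where "((\<lambda>(s,t). f s t) \<longlongrightarrow> L) (at (0,0) within ({0<..} \<times> {0<..}))"
    "f d1 d2 \<le> L" "L \<le> B"
proof -
  define S where "S = (\<lambda>(s,t). f s t) ` ({0<..d1} \<times> {0<..d2})"
  define L where "L = Sup S"
  have mem: "f s t \<in> S" if "0 < s" "s \<le> d1" "0 < t" "t \<le> d2" for s t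
    using that unfolding S_def by force
  have bdd: "bdd_above S" unfolding S_def by (rule bdd_aboveI[of _ B]) (auto intro: bd)
  have up: "f s t \<le> L" if "0 < s" "s \<le> d1" "0 < t" "t \<le> d2" for s t
    unfolding L_def using mem[OF that] bdd by (rule cSup_upper)
  have "S \<noteq> {}" using mem[of d1 d2] d by auto
  have "((\<lambda>(s,t). f s t) \<longlongrightarrow> L) (at (0,0) within ({0<..} \<times> {0<..}))"
  proof (rule tendstoI)
    fix e :: real assume "e > 0"
    then have "L - e < Sup S" by (simp add: L_def)
    then obtain v where "v \<in> S" "L - e < v" using less_cSup_iff[OF \<open>S \<noteq> {}\<close> bdd] by auto
    then obtain s0 t0 where st: "0 < s0" "s0 \<le> d1" "0 < t0" "t0 \<le> d2" "L - e < f s0 t0"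
      unfolding S_def by auto
    have "dist (case p of (s,t) \<Rightarrow> f s t) L < e"
      if "p \<in> {0<..} \<times> {0<..}" "dist p (0,0) < min s0 t0" for p
    proof -
      obtain s t where p: "p = (s,t)" "0 < s" "0 < t" using \<open>p \<in> _\<close> by auto
      have "dist s 0 < min s0 t0" "dist t 0 < min s0 t0"
        using that(2) dist_fst_le[of p "(0,0)"] dist_snd_le[of p "(0,0)"] p by auto
      then have "s \<le> s0" "t \<le> t0" using p by (auto simp: dist_real_def)
      then have "f s0 t0 \<le> f s t"
        using f1[of s s0 t0] f2[of s t t0] p st by fastforce
      moreover have "f s t \<le> L" using up[of s t] p st \<open>s \<le> s0\<close> \<open>t \<le> t0\<close> by auto
      ultimately show ?thesis using st p by (simp add: dist_real_def)
    qed
    moreover have "min s0 t0 > 0" using st by simp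
    ultimately show "eventually (\<lambda>p. dist (case p of (s,t) \<Rightarrow> f s t) L < e)
        (at (0,0) within ({0<..} \<times> {0<..}))"
      unfolding eventually_at by blast
  qed
  moreover have "f d1 d2 \<le> L" using up[of d1 d2] d by simp
  moreover have "L \<le> B" unfolding L_def
    using \<open>S \<noteq> {}\<close> by (rule cSup_least) (auto simp: S_def intro: bd)
  ultimately show ?thesis by (rule that)
qed

text \<open>Evaluating \<open>Lim\<close> requires limits to be unique, hence a nontrivial filter;
  points on the diagonal show it.\<close>

lemma corner_nontrivial: "\<not> trivial_limit (at (0::real,0::real) within ({0<..} \<times> {0<..}))"
proof -
  have "\<exists>p\<in>{0<..} \<times> {0<..}. p \<noteq> (0,0) \<and> dist p (0::real,0::real) < e" if "e > 0" for e
  proof (intro bexI conjI)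
    show "dist (e/2, e/2) (0::real,0::real) < e"
    proof -
      have "(e/2)^2 + (e/2)^2 < e^2" using that by (simp add: power2_eq_square)
      then have "sqrt ((e/2)^2 + (e/2)^2) < sqrt (e^2)" by (rule real_sqrt_less_mono)
      then show ?thesis using that by (simp add: dist_Pair_Pair dist_real_def)
    qed
  qed (use that in auto)
  then show ?thesis by (simp add: trivial_limit_within islimpt_approachable)
qed

text \<open>The joint limit is a supremum of comparison cosines, and the pair of endpoints is among
  the points compared; hence the inequality with \<open>cmp_cos x y z\<close>, the seed of the law
  of cosines inequality.\<close>

lemma alex_angle_properties:
  fixes x y z :: "'a::polish_space"
  assumes H: "hadamard_space TYPE('a)" and y: "y \<noteq> x" and z: "z \<noteq> x"
  shows "((\<lambda>(s,t). cmp_cos x (geod x y s) (geod x z t)) \<longlongrightarrow> cos (alex_angle x y z))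
      (at (0,0) within ({0<..} \<times> {0<..}))"
    and "cmp_cos x y z \<le> cos (alex_angle x y z)"
    and "0 \<le> alex_angle x y z" "alex_angle x y z \<le> pi"
proof -
  let ?F = "at (0::real,0::real) within ({0<..} \<times> {0<..})"
  let ?f = "\<lambda>s t. cmp_cos x (geod x y s) (geod x z t)"
  have d: "0 < dist x y" "0 < dist x z" using y z by auto
  obtain L where L: "((\<lambda>(s,t). ?f s t) \<longlongrightarrow> L) ?F" "?f (dist x y) (dist x z) \<le> L" "L \<le> 1"
  proof (rule antimono_tendsto_corner[OF d, of ?f 1])
    show "?f s' t \<le> ?f s t" if "0 < s" "s \<le> s'" "s' \<le> dist x y" "0 < t" "t \<le> dist x z" for s s' t
      using that by (intro cmp_cos_geod_antimono[OF H] geod_ne[OF H])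
    show "?f s t' \<le> ?f s t" if "0 < s" "s \<le> dist x y" "0 < t" "t \<le> t'" "t' \<le> dist x z" for s t t'
      using that by (subst (1 2) cmp_cos_commute) (intro cmp_cos_geod_antimono[OF H] geod_ne[OF H])
    show "?f s t \<le> 1" if "0 < s" "s \<le> dist x y" "0 < t" "t \<le> dist x z" for s t
      using that by (intro cmp_cos_bounds geod_ne[OF H])
  qed
  have yz: "cmp_cos x y z \<le> L" using L(2) by (simp add: geod_geodesic(3)[OF H])
  then have "-1 \<le> L" using cmp_cos_bounds(1)[OF y z] by linarith
  \<comment> \<open>\<open>arccos\<close> is continuous only on [-1,1], so the cosines have to lie
    there near the corner before the limit can pass through it.\<close>
  have ev: "\<forall>\<^sub>F p in ?F. (case p of (s,t) \<Rightarrow> ?f s t) \<in> {-1..1}"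
  proof -
    have "(case p of (s,t) \<Rightarrow> ?f s t) \<in> {-1..1}"
      if "p \<in> {0<..} \<times> {0<..}" "dist p (0,0) < min (dist x y) (dist x z)" for p
    proof -
      obtain s t where p: "p = (s,t)" "0 < s" "0 < t" using \<open>p \<in> _\<close> by auto
      have "s \<le> dist x y" "t \<le> dist x z"
        using that(2) dist_fst_le[of p "(0,0)"] dist_snd_le[of p "(0,0)"] p
        by (auto simp: dist_real_def)
      then show ?thesis using p cmp_cos_bounds[OF geod_ne[OF H] geod_ne[OF H]] by simp
    qed
    moreover have "min (dist x y) (dist x z) > 0" using d by simp
    ultimately show ?thesis unfolding eventually_at by blast
  qed
  have "((\<lambda>p. arccos (case p of (s,t) \<Rightarrow> ?f s t)) \<longlongrightarrow> arccos L) ?F"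
    using L(1) \<open>-1 \<le> L\<close> L(3) ev
    by (intro continuous_on_tendsto_compose[OF continuous_on_arccos']) auto
  moreover have "(\<lambda>p. arccos (case p of (s,t) \<Rightarrow> ?f s t))
      = (\<lambda>(s,t). cmp_angle x (geod x y s) (geod x z t))"
    by (auto simp: cmp_angle_eq)
  ultimately have "((\<lambda>(s,t). cmp_angle x (geod x y s) (geod x z t)) \<longlongrightarrow> arccos L) ?F" by simp
  from tendsto_Lim[OF corner_nontrivial this]
  have a: "alex_angle x y z = arccos L" unfolding alex_angle_def .
  then have c: "cos (alex_angle x y z) = L" using \<open>-1 \<le> L\<close> L(3) by simp
  show "((\<lambda>(s,t). ?f s t) \<longlongrightarrow> cos (alex_angle x y z)) ?F" using L(1) c by simp
  show "cmp_cos x y z \<le> cos (alex_angle x y z)" using c yz by simp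
  show "0 \<le> alex_angle x y z" "alex_angle x y z \<le> pi"
    unfolding a using \<open>-1 \<le> L\<close> L(3) by (auto intro: arccos_lbound arccos_ubound)
qed

text \<open>Approaching the corner along a line of prescribed slope lets points at distances
  proportional to s and t be compared at a common scale \<eta>.\<close>

lemma alex_angle_ray:
  fixes x y z :: "'a::polish_space"
  assumes H: "hadamard_space TYPE('a)" and y: "y \<noteq> x" and z: "z \<noteq> x" and "0 < s" "0 < t"
  shows "((\<lambda>\<eta>. cmp_cos x (geod x y (s * \<eta>)) (geod x z (t * \<eta>))) \<longlongrightarrow> cos (alex_angle x y z)) (at_right 0)"
proof -
  have "filterlim (\<lambda>\<eta>. (s * \<eta>, t * \<eta>)) (at (0,0) within ({0<..} \<times> {0<..})) (at_right 0)"
    unfolding filterlim_at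
  proof
    show "((\<lambda>\<eta>. (s * \<eta>, t * \<eta>)) \<longlongrightarrow> (0, 0)) (at_right 0)"
      by (auto intro!: tendsto_eq_intros)
    show "\<forall>\<^sub>F \<eta> in at_right 0. (s * \<eta>, t * \<eta>) \<in> {0<..} \<times> {0<..} \<and> (s * \<eta>, t * \<eta>) \<noteq> (0, 0)"
      using assms(4,5) by (auto simp: eventually_at_right_less intro!: eventually_mono[OF eventually_at_right_less])
  qed
  from filterlim_compose[OF alex_angle_properties(1)[OF H y z] this] show ?thesis by simp
qed

lemma alex_angle_commute:
  fixes x y z :: "'a::polish_space"
  assumes H: "hadamard_space TYPE('a)" and y: "y \<noteq> x" and z: "z \<noteq> x"
  shows "alex_angle x y z = alex_angle x z y"
proof -
  have "cos (alex_angle x y z) = cos (alex_angle x z y)"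
    using alex_angle_ray[OF H y z, of 1 1] alex_angle_ray[OF H z y, of 1 1]
    by (intro tendsto_unique[of "at_right (0::real)"]) (auto simp: cmp_cos_commute)
  then show ?thesis using alex_angle_properties(3,4)[OF H] y z by (metis arccos_cos)
qed

lemma alex_angle_self:
  fixes x y :: "'a::polish_space"
  assumes H: "hadamard_space TYPE('a)" and y: "y \<noteq> x"
  shows "alex_angle x y y = 0"
proof -
  have "cmp_cos x y y = 1" using y by (simp add: cmp_cos_def power2_eq_square)
  then have "cos (alex_angle x y y) = 1"
    using alex_angle_properties(2)[OF H y y] cos_le_one[of "alex_angle x y y"] by linarith
  then show ?thesis using alex_angle_properties(3,4)[OF H y y] by (metis arccos_1 arccos_cos)
qed

text \<open>The points on the rays to y and z at distances \<open>t\<eta>\<close> and \<open>s\<eta>\<close> are compared with the point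
  on the ray to w at distance \<open>R\<eta>\<close>, first letting \<open>\<eta> \<rightarrow> 0\<close> and then \<open>R \<rightarrow> \<infinity>\<close>: the left-hand side is a
  difference of values of the Busemann function of w in the tangent cone, so it is controlled by
  the triangle inequality of X alone, without the triangle inequality for angles.\<close>
lemma alex_angle_lipschitz_pos:
  fixes x y z w :: "'a::polish_space"
  assumes H: "hadamard_space TYPE('a)" and y: "y \<noteq> x" and z: "z \<noteq> x" and w: "w \<noteq> x"
    and t: "0 < t" and s: "0 < s"
  shows "\<bar>t * cos (alex_angle x y w) - s * cos (alex_angle x z w)\<bar>
       \<le> sqrt (t^2 + s^2 - 2 * t * s * cos (alex_angle x y z))"
proof -
  define A where "A = \<bar>t * cos (alex_angle x y w) - s * cos (alex_angle x z w)\<bar>"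
  define B where "B = sqrt (t^2 + s^2 - 2 * t * s * cos (alex_angle x y z))"
  have R: "A \<le> \<bar>t^2 - s^2\<bar> / (2 * R) + B * (1 + (t + s) / (2 * R))" if "R > 0" for R
  proof -
    let ?y = "\<lambda>\<eta>. geod x y (t * \<eta>)" and ?z = "\<lambda>\<eta>. geod x z (s * \<eta>)" and ?w = "\<lambda>\<eta>. geod x w (R * \<eta>)"
    let ?b = "\<lambda>\<eta>. sqrt (t^2 + s^2 - 2 * t * s * cmp_cos x (?y \<eta>) (?z \<eta>))"
    have l1: "((\<lambda>\<eta>. \<bar>t * cmp_cos x (?y \<eta>) (?w \<eta>) - s * cmp_cos x (?z \<eta>) (?w \<eta>)\<bar>) \<longlongrightarrow> A) (at_right 0)"
      unfolding A_def by (intro tendsto_intros alex_angle_ray[OF H] assms that)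
    have l2: "((\<lambda>\<eta>. \<bar>t^2 - s^2\<bar> / (2 * R) + ?b \<eta> * (1 + (t + s) / (2 * R)))
       \<longlongrightarrow> \<bar>t^2 - s^2\<bar> / (2 * R) + B * (1 + (t + s) / (2 * R))) (at_right 0)"
      unfolding B_def by (intro tendsto_intros alex_angle_ray[OF H] assms) (use that in auto)
    \<comment> \<open>Below this scale all three points still lie on their geodesics.\<close>
    define \<delta> where "\<delta> = min (dist x y / t) (min (dist x z / s) (dist x w / R))"
    have "\<delta> > 0" using y z w s t that by (auto simp: \<delta>_def)
    have "\<bar>t * cmp_cos x (?y \<eta>) (?w \<eta>) - s * cmp_cos x (?z \<eta>) (?w \<eta>)\<bar>
      \<le> \<bar>t^2 - s^2\<bar> / (2 * R) + ?b \<eta> * (1 + (t + s) / (2 * R))" if \<eta>: "0 < \<eta>" "\<eta> < \<delta>" for \<eta>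
    proof -
      have le: "t * \<eta> \<le> dist x y" "s * \<eta> \<le> dist x z" "R * \<eta> \<le> dist x w"
        using \<eta> s t \<open>R > 0\<close> by (auto simp: \<delta>_def pos_less_divide_eq mult.commute)
      have dx: "dist x (?y \<eta>) = t * \<eta>" "dist x (?z \<eta>) = s * \<eta>" "dist x (?w \<eta>) = R * \<eta>"
        using le \<eta> s t \<open>R > 0\<close> by (auto simp: dist_geod[OF H])
      define dy dz d where "dy = dist (?y \<eta>) (?w \<eta>)" and "dz = dist (?z \<eta>) (?w \<eta>)"
        and "d = dist (?y \<eta>) (?z \<eta>)"
      have nn: "dy \<ge> 0" "dz \<ge> 0" "d \<ge> 0" by (auto simp: dy_def dz_def d_def)
      have "\<bar>dy - dz\<bar> \<le> d" unfolding dy_def dz_def d_def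
        by (metis abs_dist_diff_le dist_commute)
      have "dy \<le> t * \<eta> + R * \<eta>" "dz \<le> s * \<eta> + R * \<eta>" unfolding dy_def dz_def
        using dx by (metis dist_commute dist_triangle)+
      have "\<bar>dy^2 - dz^2\<bar> = \<bar>dy - dz\<bar> * (dy + dz)"
        using nn by (simp add: power2_eq_square square_diff_square_factored abs_mult mult.commute)
      also have "\<dots> \<le> d * (t * \<eta> + s * \<eta> + 2 * R * \<eta>)"
        using \<open>\<bar>dy - dz\<bar> \<le> d\<close> \<open>dy \<le> _\<close> \<open>dz \<le> _\<close> nn by (intro mult_mono) auto
      finally have D: "\<bar>dy^2 - dz^2\<bar> \<le> d * (t * \<eta> + s * \<eta> + 2 * R * \<eta>)" .
      have "?b \<eta> = d / \<eta>"
      proof -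
        have "t^2 + s^2 - 2 * t * s * cmp_cos x (?y \<eta>) (?z \<eta>) = (d / \<eta>)^2"
          unfolding cmp_cos_def dx d_def[symmetric] using s t \<eta>
          by (simp add: field_simps power2_eq_square)
        then show ?thesis using nn \<eta> by (simp add: real_sqrt_unique)
      qed
      \<comment> \<open>The two contributions \<open>R / 2\<close> cancel, so only the difference of
        the squared distances to the third point still depends on \<eta>.\<close>
      have "t * cmp_cos x (?y \<eta>) (?w \<eta>) - s * cmp_cos x (?z \<eta>) (?w \<eta>)
        = (t^2 - s^2) / (2 * R) - (dy^2 - dz^2) / (2 * R * \<eta>^2)"
        unfolding cmp_cos_def dx dy_def[symmetric] dz_def[symmetric] using s t \<eta> \<open>R > 0\<close>
        by (simp add: field_simps power2_eq_square)
      also have "\<bar>\<dots>\<bar> \<le> \<bar>t^2 - s^2\<bar> / (2 * R) + \<bar>dy^2 - dz^2\<bar> / (2 * R * \<eta>^2)"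
        using \<open>R > 0\<close> by (intro order_trans[OF abs_triangle_ineq4]) (simp add: abs_divide)
      also have "\<bar>dy^2 - dz^2\<bar> / (2 * R * \<eta>^2) \<le> d * (t * \<eta> + s * \<eta> + 2 * R * \<eta>) / (2 * R * \<eta>^2)"
        using D \<open>R > 0\<close> by (intro divide_right_mono) auto
      also have "\<dots> = d / \<eta> * (1 + (t + s) / (2 * R))"
        using \<open>R > 0\<close> \<eta> by (simp add: field_simps power2_eq_square)
      finally show ?thesis using \<open>?b \<eta> = d / \<eta>\<close> by simp
    qed
    then have "\<forall>\<^sub>F \<eta> in at_right 0. \<bar>t * cmp_cos x (?y \<eta>) (?w \<eta>) - s * cmp_cos x (?z \<eta>) (?w \<eta>)\<bar>
      \<le> \<bar>t^2 - s^2\<bar> / (2 * R) + ?b \<eta> * (1 + (t + s) / (2 * R))"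
      unfolding eventually_at_right_field using \<open>\<delta> > 0\<close> by blast
    from tendsto_le[OF _ l2 l1 this] show ?thesis by simp
  qed
  have "((\<lambda>R. \<bar>t^2 - s^2\<bar> / (2 * R) + B * (1 + (t + s) / (2 * R))) \<longlongrightarrow> 0 + B * (1 + 0)) at_top"
    by (intro tendsto_intros tendsto_divide_0[OF tendsto_const] filterlim_at_top_imp_at_infinity
        filterlim_tendsto_pos_mult_at_top[OF tendsto_const] filterlim_ident) auto
  moreover have "\<forall>\<^sub>F R in at_top. A \<le> \<bar>t^2 - s^2\<bar> / (2 * R) + B * (1 + (t + s) / (2 * R))"
    using eventually_gt_at_top[of "0::real"] by eventually_elim (rule R)
  ultimately have "A \<le> 0 + B * (1 + 0)" by (intro tendsto_lowerbound) auto
  then show ?thesis by (simp add: A_def B_def)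
qed

lemma alex_angle_lipschitz:
  fixes x y z w :: "'a::polish_space"
  assumes H: "hadamard_space TYPE('a)" and y: "y \<noteq> x" and z: "z \<noteq> x" and w: "w \<noteq> x"
    and t: "0 \<le> t" and s: "0 \<le> s"
  shows "\<bar>t * cos (alex_angle x y w) - s * cos (alex_angle x z w)\<bar>
       \<le> sqrt (t^2 + s^2 - 2 * t * s * cos (alex_angle x y z))"
proof (cases "t = 0 \<or> s = 0")
  case True
  have "\<bar>r * cos u\<bar> \<le> r" if "0 \<le> r" for r u :: real
    using mult_left_mono[OF abs_cos_le_one that, of u] that by (simp add: abs_mult)
  with True s t show ?thesis by auto
next
  case False
  then show ?thesis using assms by (intro alex_angle_lipschitz_pos) auto
qed

section \<open>The tangent cone\<close>

text \<open>A chord of the unit circle is no longer than its arc.\<close>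

lemma sqrt_two_minus_two_cos_le:
  fixes a :: real
  assumes "0 \<le> a"
  shows "sqrt (2 - 2 * cos a) \<le> a"
proof -
  have "2 - 2 * cos a = (2 * sin (a/2))^2"
    using cos_double_sin[of "a/2"] by (simp add: power2_eq_square)
  then have "sqrt (2 - 2 * cos a) = \<bar>2 * sin (a/2)\<bar>" by (simp only: real_sqrt_abs)
  then show ?thesis using abs_sin_x_le_abs_x[of "a/2"] assms by (simp add: abs_mult)
qed

text \<open>The case of unit lengths. It takes the place of the triangle inequality for angles when
  limits of angles along Cauchy sequences of directions are shown to exist.\<close>

lemma cos_alex_angle_diff:
  fixes x y z w :: "'a::polish_space"
  assumes "hadamard_space TYPE('a)" "y \<noteq> x" "z \<noteq> x" "w \<noteq> x"
  shows "\<bar>cos (alex_angle x y w) - cos (alex_angle x z w)\<bar> \<le> alex_angle x y z"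
  using alex_angle_lipschitz[OF assms, of 1 1]
    sqrt_two_minus_two_cos_le[OF alex_angle_properties(3)[OF assms(1-3)]] by simp

lemma dir_seq_const:
  fixes x a :: "'a::polish_space"
  assumes "hadamard_space TYPE('a)" "a \<noteq> x"
  shows "dir_seq x (\<lambda>_. a)"
  using assms alex_angle_self[OF assms] by (simp add: dir_seq_def)

lemma dir_angle_const: "dir_angle x (\<lambda>_. a) (\<lambda>_. b) = alex_angle x a b"
  by (simp add: dir_angle_def lim_const)

text \<open>The cosines form a Cauchy sequence, as is seen by changing one of the two directions at
  a time; \<open>arccos\<close> then returns to the angles, whose \<open>lim\<close> defines
  \<open>dir_angle\<close>.\<close>

lemma dir_angle_tendsto:
  fixes x :: "'a::polish_space"
  assumes H: "hadamard_space TYPE('a)" and \<sigma>: "dir_seq x \<sigma>" and \<tau>: "dir_seq x \<tau>"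
  shows "(\<lambda>n. cos (alex_angle x (\<sigma> n) (\<tau> n))) \<longlonglongrightarrow> cos (dir_angle x \<sigma> \<tau>)"
proof -
  have ne: "\<sigma> n \<noteq> x" "\<tau> n \<noteq> x" for n using \<sigma> \<tau> by (auto simp: dir_seq_def)
  let ?c = "\<lambda>n. cos (alex_angle x (\<sigma> n) (\<tau> n))"
  have "Cauchy ?c"
  proof (rule CauchyI)
    fix e :: real assume "e > 0"
    then obtain N1 N2 where N: "\<forall>m\<ge>N1. \<forall>n\<ge>N1. alex_angle x (\<sigma> m) (\<sigma> n) < e/2"
      "\<forall>m\<ge>N2. \<forall>n\<ge>N2. alex_angle x (\<tau> m) (\<tau> n) < e/2"
      using \<sigma> \<tau> unfolding dir_seq_def by (meson half_gt_zero)
    have "norm (?c m - ?c n) < e" if "m \<ge> max N1 N2" "n \<ge> max N1 N2" for m n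
    proof -
      have "\<bar>?c m - cos (alex_angle x (\<sigma> n) (\<tau> m))\<bar> < e/2"
        using cos_alex_angle_diff[OF H ne(1)[of m] ne(1)[of n] ne(2)[of m]] N(1) that by fastforce
      moreover have "\<bar>cos (alex_angle x (\<sigma> n) (\<tau> m)) - ?c n\<bar> < e/2"
        using cos_alex_angle_diff[OF H ne(2)[of m] ne(2)[of n] ne(1)[of n]] N(2) that
        by (fastforce simp: alex_angle_commute[OF H ne(1) ne(2)])
      ultimately show ?thesis by (auto simp: abs_if split: if_splits)
    qed
    then show "\<exists>M. \<forall>m\<ge>M. \<forall>n\<ge>M. norm (?c m - ?c n) < e" by blast
  qed
  then obtain l where l: "?c \<longlonglongrightarrow> l" using Cauchy_convergent_iff convergentD by blast
  have "l \<in> {-1..1}"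
    using l by (rule closed_sequentially[OF closed_atLeastAtMost, rotated]) auto
  then have "(\<lambda>n. arccos (?c n)) \<longlonglongrightarrow> arccos l"
    using l by (intro continuous_on_tendsto_compose[OF continuous_on_arccos']) auto
  moreover have "(\<lambda>n. arccos (?c n)) = (\<lambda>n. alex_angle x (\<sigma> n) (\<tau> n))"
    using alex_angle_properties(3,4)[OF H ne(1) ne(2)] by (simp add: arccos_cos)
  ultimately have "dir_angle x \<sigma> \<tau> = arccos l" unfolding dir_angle_def by (simp add: limI)
  then show ?thesis using l \<open>l \<in> _\<close> by simp
qed

lemma dir_angle_commute:
  fixes x :: "'a::polish_space"
  assumes "hadamard_space TYPE('a)" "dir_seq x \<sigma>" "dir_seq x \<tau>"
  shows "dir_angle x \<sigma> \<tau> = dir_angle x \<tau> \<sigma>"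
  using assms alex_angle_commute[OF assms(1)] by (simp add: dir_angle_def dir_seq_def)

lemma dir_angle_self:
  fixes x :: "'a::polish_space"
  assumes "hadamard_space TYPE('a)" "dir_seq x \<sigma>"
  shows "dir_angle x \<sigma> \<sigma> = 0"
  using assms alex_angle_self[OF assms(1)] by (simp add: dir_angle_def dir_seq_def)

lemma dir_angle_lipschitz:
  fixes x :: "'a::polish_space"
  assumes H: "hadamard_space TYPE('a)" and \<sigma>: "dir_seq x \<sigma>" and \<tau>: "dir_seq x \<tau>" and \<rho>: "dir_seq x \<rho>"
    and "0 \<le> t" "0 \<le> s"
  shows "\<bar>t * cos (dir_angle x \<sigma> \<rho>) - s * cos (dir_angle x \<tau> \<rho>)\<bar>
       \<le> sqrt (t^2 + s^2 - 2 * t * s * cos (dir_angle x \<sigma> \<tau>))"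
proof (rule tendsto_le[OF sequentially_bot])
  show "(\<lambda>n. \<bar>t * cos (alex_angle x (\<sigma> n) (\<rho> n)) - s * cos (alex_angle x (\<tau> n) (\<rho> n))\<bar>)
      \<longlonglongrightarrow> \<bar>t * cos (dir_angle x \<sigma> \<rho>) - s * cos (dir_angle x \<tau> \<rho>)\<bar>"
    by (intro tendsto_intros dir_angle_tendsto assms)
  show "(\<lambda>n. sqrt (t^2 + s^2 - 2 * t * s * cos (alex_angle x (\<sigma> n) (\<tau> n))))
      \<longlonglongrightarrow> sqrt (t^2 + s^2 - 2 * t * s * cos (dir_angle x \<sigma> \<tau>))"
    by (intro tendsto_intros dir_angle_tendsto assms)
qed (use assms in \<open>auto intro!: always_eventually alex_angle_lipschitz simp: dir_seq_def\<close>)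

section \<open>Pairing, norm and metric on representatives and on their classes\<close>

definition rg :: "'a::metric_space trep \<Rightarrow> 'a trep \<Rightarrow> real" where
  "rg r r' = (case r of (x, t, \<sigma>) \<Rightarrow> case r' of (_, s, \<tau>) \<Rightarrow> t * s * cos (dir_angle x \<sigma> \<tau>))"

lemma tg_eq_rg: "tg u v = rg (trep_of u) (trep_of v)"
  by (simp add: tg_def rg_def)

lemma rdist_eq: "rdist r r' = sqrt ((fst (snd r))^2 + (fst (snd r'))^2 - 2 * rg r r')"
  by (simp add: rdist_def rg_def mult.assoc split: prod.split)

lemma cone_law_ge_diff:
  fixes t s c :: real
  assumes "0 \<le> t" "0 \<le> s" "c \<le> 1"
  shows "(t - s)^2 \<le> t^2 + s^2 - 2 * (t * s * c)"
  using mult_left_mono[OF assms(3), of "2 * t * s"] assms(1,2) by (simp add: power2_diff)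

text \<open>Used in two ways: at \<open>rdist\<close> zero it makes the pairing independent of the
  representative, and in general it is the Lipschitz bound on the tangent cone.\<close>

lemma rg_lipschitz:
  fixes x :: "'a::polish_space"
  assumes H: "hadamard_space TYPE('a)" and v: "tvalid r" "tvalid r'" "tvalid q"
    and b: "fst r = x" "fst r' = x" "fst q = x"
  shows "\<bar>rg r q - rg r' q\<bar> \<le> fst (snd q) * rdist r r'"
proof -
  obtain t \<sigma> s \<tau> p \<rho> where e: "r = (x,t,\<sigma>)" "r' = (x,s,\<tau>)" "q = (x,p,\<rho>)"
    using b by (cases r; cases r'; cases q) auto
  have nn: "0 \<le> t" "0 \<le> s" "0 \<le> p" using v by (auto simp: e tvalid_def)
  have cos_le: "\<bar>a * cos u\<bar> \<le> a" if "0 \<le> a" for a u :: real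
    using mult_left_mono[OF abs_cos_le_one that, of u] that by (simp add: abs_mult)
  \<comment> \<open>For \<open>p = 0\<close> both sides of the goal vanish, and
    \<open>tvalid\<close> then leaves the direction of q unconstrained. The same holds for t or s,
    where \<open>rdist\<close> reduces to the other length.\<close>
  have "\<bar>t * cos (dir_angle x \<sigma> \<rho>) - s * cos (dir_angle x \<tau> \<rho>)\<bar> \<le> rdist r r'" if "p \<noteq> 0"
  proof (cases "t = 0 \<or> s = 0")
    case True
    then show ?thesis using cos_le nn by (auto simp: rdist_def e)
  next
    case False
    then have "dir_seq x \<sigma>" "dir_seq x \<tau>" "dir_seq x \<rho>"
      using v that by (auto simp: e tvalid_def)
    from dir_angle_lipschitz[OF H this nn(1,2)] show ?thesis by (simp add: rdist_def e)
  qed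
  moreover have "\<bar>rg r q - rg r' q\<bar>
      = p * \<bar>t * cos (dir_angle x \<sigma> \<rho>) - s * cos (dir_angle x \<tau> \<rho>)\<bar>"
  proof -
    have "rg r q - rg r' q = p * (t * cos (dir_angle x \<sigma> \<rho>) - s * cos (dir_angle x \<tau> \<rho>))"
      by (simp add: rg_def e algebra_simps)
    then show ?thesis using nn by (simp add: abs_mult)
  qed
  ultimately show ?thesis using nn by (cases "p = 0") (auto simp: e intro: mult_left_mono)
qed

lemma rg_commute:
  fixes r q :: "'a::polish_space trep"
  assumes H: "hadamard_space TYPE('a)" and v: "tvalid r" "tvalid q"
    and b: "fst r = fst q"
  shows "rg r q = rg q r"
proof -
  obtain x t \<sigma> p \<rho> where e: "r = (x,t,\<sigma>)" "q = (x,p,\<rho>)"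
    using b by (cases r; cases q) auto
  show ?thesis
  proof (cases "t = 0 \<or> p = 0")
    case True
    then show ?thesis by (auto simp: e rg_def)
  next
    case False
    then have "dir_seq x \<sigma>" "dir_seq x \<rho>" using v by (auto simp: e tvalid_def)
    from dir_angle_commute[OF H this] show ?thesis by (simp add: rg_def e)
  qed
qed

lemma rdist_self:
  fixes r :: "'a::polish_space trep"
  assumes H: "hadamard_space TYPE('a)" and v: "tvalid r"
  shows "rdist r r = 0"
proof -
  obtain x t \<sigma> where e: "r = (x,t,\<sigma>)" by (cases r) auto
  show ?thesis
  proof (cases "t = 0")
    case False
    then have "dir_seq x \<sigma>" using v by (auto simp: e tvalid_def)
    then show ?thesis by (simp add: rdist_def e dir_angle_self[OF H] power2_eq_square)
  qed (simp add: rdist_def e)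
qed

text \<open>Representatives at distance zero have equal lengths, so \<open>tnorm\<close> does not
  depend on the selected one.\<close>

lemma rdist_ge_norm_diff:
  assumes "tvalid r" "tvalid q"
  shows "\<bar>fst (snd r) - fst (snd q)\<bar> \<le> rdist r q"
proof -
  obtain x t \<sigma> y s \<tau> where e: "r = (x,t,\<sigma>)" "q = (y,s,\<tau>)" by (cases r; cases q) auto
  have "sqrt ((t - s)^2) \<le> rdist r q"
    unfolding rdist_eq rg_def e prod.case fst_conv snd_conv using assms
    by (intro real_sqrt_le_mono cone_law_ge_diff cos_le_one) (auto simp: e tvalid_def)
  then show ?thesis by (simp add: e)
qed

lemma trep_of_tclass:
  fixes r :: "'a::polish_space trep"
  assumes H: "hadamard_space TYPE('a)" and v: "tvalid r"
  shows "tvalid (trep_of (tclass r))" "fst (trep_of (tclass r)) = fst r"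
    "rdist r (trep_of (tclass r)) = 0" "fst (snd (trep_of (tclass r))) = fst (snd r)"
proof -
  have "r \<in> tclass r" using v rdist_self[OF H v] by (simp add: tclass_def)
  then have "trep_of (tclass r) \<in> tclass r" unfolding trep_of_def by (rule someI)
  then show *: "tvalid (trep_of (tclass r))" "fst (trep_of (tclass r)) = fst r"
    "rdist r (trep_of (tclass r)) = 0" by (auto simp: tclass_def)
  show "fst (snd (trep_of (tclass r))) = fst (snd r)"
    using rdist_ge_norm_diff[OF v *(1)] *(3) by simp
qed

lemma tangent_space_trep_of:
  fixes x :: "'a::polish_space"
  assumes H: "hadamard_space TYPE('a)" and "u \<in> tangent_space x"
  shows "tvalid (trep_of u)" "fst (trep_of u) = x" "0 \<le> tnorm u"
proof -
  obtain r where r: "u = tclass r" "tvalid r" "fst r = x"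
    using assms by (auto simp: tangent_space_def)
  show "tvalid (trep_of u)" "fst (trep_of u) = x" using trep_of_tclass[OF H r(2)] r by auto
  then show "0 \<le> tnorm u" unfolding tnorm_def tvalid_def by (auto split: prod.splits)
qed

text \<open>\<open>rg_lipschitz\<close> exchanges a first argument at distance zero; symmetry moves
  the other argument into that place.\<close>

lemma tg_tclass:
  fixes r q :: "'a::polish_space trep"
  assumes H: "hadamard_space TYPE('a)" and v: "tvalid r" "tvalid q" and b: "fst r = x" "fst q = x"
  shows "tg (tclass r) (tclass q) = rg r q"
proof -
  note R = trep_of_tclass[OF H v(1)] and Q = trep_of_tclass[OF H v(2)]
  have "rg r q = rg (trep_of (tclass r)) q"
    using rg_lipschitz[OF H v(1) R(1) v(2), of x] R b by simp
  also have "\<dots> = rg q (trep_of (tclass r))" using R b v by (intro rg_commute[OF H]) auto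
  also have "\<dots> = rg (trep_of (tclass q)) (trep_of (tclass r))"
    using rg_lipschitz[OF H v(2) Q(1) R(1), of x] R Q b by simp
  also have "\<dots> = rg (trep_of (tclass r)) (trep_of (tclass q))"
    using R Q b by (intro rg_commute[OF H]) auto
  finally show ?thesis by (simp add: tg_eq_rg)
qed

lemma tdist_eq: "tdist u v = sqrt ((tnorm u)^2 + (tnorm v)^2 - 2 * tg u v)"
  by (simp add: tdist_def rdist_eq tnorm_def tg_eq_rg)

lemma tg_commute:
  fixes x :: "'a::polish_space"
  assumes H: "hadamard_space TYPE('a)" and "u \<in> tangent_space x" "v \<in> tangent_space x"
  shows "tg u v = tg v u"
  using tangent_space_trep_of[OF H] assms unfolding tg_eq_rg by (intro rg_commute[OF H]) auto

lemma tg_lipschitz: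
  fixes x :: "'a::polish_space"
  assumes H: "hadamard_space TYPE('a)"
    and "u \<in> tangent_space x" "v \<in> tangent_space x" "w \<in> tangent_space x"
  shows "\<bar>tg u w - tg v w\<bar> \<le> tnorm w * tdist u v"
  using tangent_space_trep_of[OF H] assms unfolding tg_eq_rg tnorm_def tdist_def
  by (intro rg_lipschitz[OF H]) auto

lemma tnorm_lipschitz:
  fixes x :: "'a::polish_space"
  assumes H: "hadamard_space TYPE('a)" and "u \<in> tangent_space x" "v \<in> tangent_space x"
  shows "\<bar>tnorm u - tnorm v\<bar> \<le> tdist u v"
  using tangent_space_trep_of[OF H] assms unfolding tnorm_def tdist_def
  by (intro rdist_ge_norm_diff) auto

lemma abs_tg_le:
  fixes x :: "'a::polish_space"
  assumes H: "hadamard_space TYPE('a)" and "u \<in> tangent_space x" "v \<in> tangent_space x"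
  shows "\<bar>tg u v\<bar> \<le> tnorm u * tnorm v"
proof -
  have "0 \<le> tnorm u * tnorm v" using tangent_space_trep_of(3)[OF H] assms by simp
  obtain a where "tg u v = tnorm u * tnorm v * cos a"
    by (cases "trep_of u"; cases "trep_of v") (auto simp: tg_def tnorm_def)
  then show ?thesis
    using mult_left_mono[OF abs_cos_le_one \<open>0 \<le> tnorm u * tnorm v\<close>, of a]
      abs_mult[of "tnorm u * tnorm v" "cos a"] abs_of_nonneg[OF \<open>0 \<le> tnorm u * tnorm v\<close>]
    by linarith
qed

section \<open>Logarithms and the law of cosines inequality\<close>

definition log_rep :: "'a::metric_space \<Rightarrow> 'a \<Rightarrow> 'a trep" where
  "log_rep x a = (x, dist x a, \<lambda>_. a)"

text \<open>No case distinction remains, because \<open>log_rep x x\<close> is the very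
  representative from which \<open>tzero x\<close> is formed.\<close>

lemma tlog_eq: "tlog x a = tclass (log_rep x a)"
  by (simp add: tlog_def log_rep_def tzero_def)

lemma tvalid_log_rep:
  fixes x a :: "'a::polish_space"
  assumes "hadamard_space TYPE('a)"
  shows "tvalid (log_rep x a)"
  using dir_seq_const[OF assms, of a x] by (auto simp: log_rep_def tvalid_def)

lemma tlog_in_tangent_space:
  fixes x a :: "'a::polish_space"
  assumes "hadamard_space TYPE('a)"
  shows "tlog x a \<in> tangent_space x"
  using tvalid_log_rep[OF assms, of x a] by (auto simp: tangent_space_def tlog_eq log_rep_def)

lemma tnorm_tlog:
  fixes x a :: "'a::polish_space"
  assumes "hadamard_space TYPE('a)"
  shows "tnorm (tlog x a) = dist x a"
  using trep_of_tclass(4)[OF assms tvalid_log_rep[OF assms]]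
  by (simp add: tnorm_def tlog_eq) (simp add: log_rep_def)

text \<open>The comparison cosine is at most the cosine of the angle; multiplying by both lengths
  gives the claim. If a or b is x, equality holds.\<close>

lemma tg_tlog_ge:
  fixes x a b :: "'a::polish_space"
  assumes H: "hadamard_space TYPE('a)"
  shows "((dist x a)^2 + (dist x b)^2 - (dist a b)^2) / 2 \<le> tg (tlog x a) (tlog x b)"
proof -
  have *: "tg (tlog x a) (tlog x b) = dist x a * dist x b * cos (alex_angle x a b)"
    unfolding tlog_eq by (subst tg_tclass[OF H tvalid_log_rep[OF H] tvalid_log_rep[OF H], where x = x])
      (simp_all add: log_rep_def rg_def dir_angle_const)
  show ?thesis
  proof (cases "a = x \<or> b = x")
    case True
    then show ?thesis unfolding * by (auto simp: dist_commute)
  next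
    case False
    then have "dist x a * dist x b * cmp_cos x a b \<le> dist x a * dist x b * cos (alex_angle x a b)"
      by (intro mult_left_mono alex_angle_properties(2)[OF H]) auto
    moreover have "dist x a * dist x b * cmp_cos x a b = ((dist x a)^2 + (dist x b)^2 - (dist a b)^2) / 2"
      using False by (auto simp: cmp_cos_def)
    ultimately show ?thesis unfolding * by simp
  qed
qed

text \<open>The law of cosines inequality read as a bound on the cone metric: logarithms do not
  increase distances.\<close>

lemma tdist_tlog_le:
  fixes x a b :: "'a::polish_space"
  assumes H: "hadamard_space TYPE('a)"
  shows "tdist (tlog x a) (tlog x b) \<le> dist a b"
proof -
  have "(tnorm (tlog x a))^2 + (tnorm (tlog x b))^2 - 2 * tg (tlog x a) (tlog x b) \<le> (dist a b)^2"
    using tg_tlog_ge[OF H, of x a b] by (simp add: tnorm_tlog[OF H])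
  from real_sqrt_le_mono[OF this] show ?thesis by (simp add: tdist_eq)
qed

text \<open>This serves both to replace the new point by the old one in the noise term and to show
  that the noise is continuous in the point.\<close>

lemma tg_tlog_lipschitz:
  fixes x a b :: "'a::polish_space"
  assumes H: "hadamard_space TYPE('a)" and u: "u \<in> tangent_space x"
  shows "\<bar>tg u (tlog x a) - tg u (tlog x b)\<bar> \<le> tnorm u * dist a b"
proof -
  note L = tlog_in_tangent_space[OF H]
  have "\<bar>tg u (tlog x a) - tg u (tlog x b)\<bar> \<le> tnorm u * tdist (tlog x a) (tlog x b)"
    using tg_lipschitz[OF H L L u] by (simp add: tg_commute[OF H u L])
  also have "\<dots> \<le> tnorm u * dist a b"
    using tdist_tlog_le[OF H] tangent_space_trep_of(3)[OF H u] by (rule mult_left_mono)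
  finally show ?thesis .
qed

lemma tg_tscale:
  fixes x :: "'a::polish_space"
  assumes H: "hadamard_space TYPE('a)" and c: "0 \<le> c"
    and u: "u \<in> tangent_space x" and v: "v \<in> tangent_space x"
  shows "tg (tscale c u) v = c * tg u v"
proof -
  obtain t \<sigma> where r: "trep_of u = (x, t, \<sigma>)"
    using tangent_space_trep_of(2)[OF H u] by (cases "trep_of u") auto
  obtain q where q: "v = tclass q" "tvalid q" "fst q = x"
    using v by (auto simp: tangent_space_def)
  have vu: "tvalid (x, t, \<sigma>)" using tangent_space_trep_of(1)[OF H u] r by simp
  then have vc: "tvalid (x, c * t, \<sigma>)" using c by (auto simp: tvalid_def)
  note Q = trep_of_tclass[OF H q(2), folded q(1)]
  have "tg (tscale c u) v = rg (x, c * t, \<sigma>) q"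
    unfolding tscale_def r q(1) prod.case by (rule tg_tclass[OF H vc q(2), where x = x]) (simp_all add: q)
  also have "\<dots> = rg q (x, c * t, \<sigma>)" using vc q by (intro rg_commute[OF H]) auto
  also have "\<dots> = rg (trep_of v) (x, c * t, \<sigma>)"
    using rg_lipschitz[OF H q(2) Q(1) vc, of x] Q q by simp
  also have "\<dots> = rg (x, c * t, \<sigma>) (trep_of v)" using vc Q q by (intro rg_commute[OF H]) auto
  also have "\<dots> = c * tg u v" by (simp add: tg_eq_rg r rg_def split: prod.split)
  finally show ?thesis .
qed

text \<open>\<open>tborel\<close> is generated by the sets open for \<open>tdist\<close>, and
  preimages of open sets under a \<open>tdist\<close>-Lipschitz function are such sets. Tangent
  vectors are sets of representatives, so the topology is handled through \<open>tdist\<close> by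
  hand.\<close>

lemma measurable_tborel:
  fixes f :: "'a::polish_space tvec \<Rightarrow> real"
  assumes "\<And>u v. u \<in> tangent_space x \<Longrightarrow> v \<in> tangent_space x \<Longrightarrow> \<bar>f u - f v\<bar> \<le> K * tdist u v"
    and K: "K \<ge> 0"
  shows "f \<in> borel_measurable (tborel x)"
proof (rule borel_measurableI)
  have sub: "{U. t_open x U} \<subseteq> Pow (tangent_space x)" by (auto simp: t_open_def)
  fix S :: "real set" assume "open S"
  have "t_open x (f -` S \<inter> tangent_space x)"
    unfolding t_open_def
  proof (intro conjI ballI)
    fix u assume u: "u \<in> f -` S \<inter> tangent_space x"
    then obtain e where e: "e > 0" "\<And>y. dist y (f u) < e \<Longrightarrow> y \<in> S"
      using \<open>open S\<close> unfolding open_dist by blast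
    have "v \<in> f -` S \<inter> tangent_space x" if "v \<in> tangent_space x" "tdist u v < e / (K + 1)" for v
    proof -
      have "K * tdist u v < e"
      proof (cases "tdist u v \<le> 0")
        case True
        then show ?thesis using mult_nonneg_nonpos[OF K True] e(1) by linarith
      next
        case False
        then have "K * tdist u v \<le> (K + 1) * tdist u v" by (simp add: distrib_right)
        also have "\<dots> < e" using that(2) K by (simp add: pos_less_divide_eq mult.commute)
        finally show ?thesis .
      qed
      then have "\<bar>f u - f v\<bar> < e" using assms(1)[of u v] u that by auto
      then show ?thesis using e(2)[of "f v"] that by (simp add: dist_real_def abs_minus_commute)
    qed
    moreover have "e / (K + 1) > 0" using e K by simp
    ultimately show "\<exists>e>0. {v \<in> tangent_space x. tdist u v < e} \<subseteq> f -` S \<inter> tangent_space x" by blast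
  qed auto
  then show "f -` S \<inter> space (tborel x) \<in> sets (tborel x)"
    unfolding tborel_def using sub by (simp add: space_measure_of sets_measure_of)
qed

lemma tnorm_measurable:
  fixes x :: "'a::polish_space"
  assumes "hadamard_space TYPE('a)"
  shows "tnorm \<in> borel_measurable (tborel x)"
  using tnorm_lipschitz[OF assms] by (intro measurable_tborel[of x _ 1]) auto

lemma tg_measurable:
  fixes x :: "'a::polish_space"
  assumes H: "hadamard_space TYPE('a)" and w: "w \<in> tangent_space x"
  shows "(\<lambda>u. tg u w) \<in> borel_measurable (tborel x)"
  using tg_lipschitz[OF H _ _ w] tangent_space_trep_of(3)[OF H w] by (rule measurable_tborel)

section \<open>Resolvents of monotone vector fields\<close>

text \<open>Monotonicity between z1 and z2 combined with the law of cosines inequality at both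
  points. For \<open>x = y\<close> the right-hand side is zero, which gives uniqueness; in general
  it gives continuity.\<close>

lemma resolvent_two_points:
  fixes x y :: "'a::polish_space"
  assumes H: "hadamard_space TYPE('a)" and B: "monotone_vf B" and l: "l > 0"
    and z1: "tscale (1 / l) (tlog z1 x) \<in> B z1" and z2: "tscale (1 / l) (tlog z2 y) \<in> B z2"
  shows "2 * (dist z1 z2)^2 \<le> (dist x z2)^2 - (dist x z1)^2 + (dist y z1)^2 - (dist y z2)^2"
proof -
  note L = tlog_in_tangent_space[OF H]
  have "tg (tscale (1 / l) (tlog z1 x)) (tlog z1 z2) \<le> - tg (tscale (1 / l) (tlog z2 y)) (tlog z2 z1)"
    using B z1 z2 unfolding monotone_vf_def by blast
  then have "(1 / l) * (tg (tlog z1 x) (tlog z1 z2) + tg (tlog z2 y) (tlog z2 z1)) \<le> 0"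
    using l by (simp add: tg_tscale[OF H _ L L] distrib_left)
  then have "tg (tlog z1 x) (tlog z1 z2) + tg (tlog z2 y) (tlog z2 z1) \<le> 0"
    using l by (simp add: divide_le_0_iff)
  then show ?thesis
    using tg_tlog_ge[OF H, of z1 x z2] tg_tlog_ge[OF H, of z2 y z1]
    by (simp add: dist_commute field_simps)
qed

lemma resolvent_mem:
  fixes x :: "'a::polish_space"
  assumes H: "hadamard_space TYPE('a)" and B: "monotone_vf B" "surjectivity_cond B" and l: "l > 0"
  shows "tscale (1 / l) (tlog (resolvent B l x) x) \<in> B (resolvent B l x)"
  unfolding resolvent_def
proof (rule theI')
  show "\<exists>!z. tscale (1 / l) (tlog z x) \<in> B z"
  proof (rule ex_ex1I)
    show "\<exists>z. tscale (1 / l) (tlog z x) \<in> B z" using B(2) l unfolding surjectivity_cond_def by blast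
    show "z1 = z2" if "tscale (1 / l) (tlog z1 x) \<in> B z1" "tscale (1 / l) (tlog z2 x) \<in> B z2" for z1 z2
      using resolvent_two_points[OF H B(1) l that] by simp
  qed
qed

text \<open>Needed for the measurability of the iterates. A crude modulus suffices, obtained by
  solving a quadratic inequality for the distance of the two resolvents.\<close>

lemma resolvent_continuous:
  fixes B :: "'a::polish_space \<Rightarrow> 'a tvec set"
  assumes H: "hadamard_space TYPE('a)" and B: "monotone_vf B" "surjectivity_cond B" and l: "l > 0"
  shows "continuous_on UNIV (resolvent B l)"
  unfolding continuous_on_def
proof
  fix x :: 'a
  let ?J = "resolvent B l"
  define m where "m = dist x (?J x)"
  have bound: "dist (?J y) (?J x)
      \<le> dist y x / 2 + sqrt (dist y x * (2 * m + dist y x) + (dist y x)^2 / 4)" for y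
  proof -
    define d e where "d = dist y x" and "e = dist (?J y) (?J x)"
    have nn: "d \<ge> 0" "e \<ge> 0" "m \<ge> 0" by (auto simp: d_def e_def m_def)
    define p q r where "p = dist x (?J y)" and "q = dist y (?J x)" and "r = dist y (?J y)"
    have tri: "p \<le> m + e" "r \<le> m + e + d" "q \<le> m + d" "\<bar>p - r\<bar> \<le> d" "\<bar>q - m\<bar> \<le> d"
      unfolding p_def q_def r_def m_def d_def e_def by metric+
    have "2 * e^2 \<le> p^2 - m^2 + q^2 - r^2"
      using resolvent_two_points[OF H B(1) l resolvent_mem[OF H B l] resolvent_mem[OF H B l], of x y]
      unfolding p_def q_def r_def m_def e_def by (simp add: dist_commute)
    also have "\<dots> = (p - r) * (p + r) + (q - m) * (q + m)" by (simp add: power2_eq_square algebra_simps)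
    also have "\<dots> \<le> d * (2 * m + 2 * e + d) + d * (2 * m + d)"
    proof (rule add_mono)
      have "p \<ge> 0" "q \<ge> 0" "r \<ge> 0" by (auto simp: p_def q_def r_def)
      then show "(p - r) * (p + r) \<le> d * (2 * m + 2 * e + d)" "(q - m) * (q + m) \<le> d * (2 * m + d)"
        using tri nn by (auto intro!: mult_mono)
    qed
    \<comment> \<open>Halved, the bound reads \<open>e^2 - d * e \<le> d * (2 * m + d)\<close>; the
      square is then completed.\<close>
    finally have "(e - d / 2)^2 \<le> d * (2 * m + d) + d^2 / 4"
      by (simp add: power2_eq_square algebra_simps)
    then have "e - d / 2 \<le> sqrt (d * (2 * m + d) + d^2 / 4)" by (rule real_le_rsqrt)
    then show ?thesis by (simp add: d_def e_def)
  qed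
  have "((\<lambda>y. dist (?J y) (?J x)) \<longlongrightarrow> 0) (at x)"
  proof (rule tendsto_sandwich[OF _ _ tendsto_const])
    show "((\<lambda>y. dist y x / 2 + sqrt (dist y x * (2 * m + dist y x) + (dist y x)^2 / 4)) \<longlongrightarrow> 0) (at x)"
      by (auto intro!: tendsto_eq_intros)
  qed (use bound in auto)
  then show "(?J \<longlongrightarrow> ?J x) (at x within UNIV)" by (subst tendsto_dist_iff)
qed

lemma resolvent_step:
  fixes x p :: "'a::polish_space"
  assumes H: "hadamard_space TYPE('a)" and B: "surjectivity_cond B" "monotone_vf B"
    "strongly_monotone_vf B a" and l: "l > 0" and \<phi>: "\<phi> \<in> B p" "\<phi> \<in> tangent_space p"
    and z: "z = resolvent B l x"
  shows "(1 + 2 * l * a) * (dist z p)^2 + (dist z x)^2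
    \<le> (dist x p)^2 - 2 * l * tg \<phi> (tlog p x) + 2 * l * tnorm \<phi> * dist z x"
proof -
  note L = tlog_in_tangent_space[OF H]
  have mem: "tscale (1 / l) (tlog z x) \<in> B z" unfolding z by (rule resolvent_mem[OF H B(2,1) l])
  then have "tg (tscale (1 / l) (tlog z x)) (tlog z p) \<le> - tg \<phi> (tlog p z) - a * (dist z p)^2"
    using B(3) \<phi>(1) unfolding strongly_monotone_vf_def by blast
  then have "tg (tlog z x) (tlog z p) / l \<le> - tg \<phi> (tlog p z) - a * (dist z p)^2"
    using l by (simp add: tg_tscale[OF H _ L L])
  from mult_left_mono[OF this less_imp_le[OF l]]
  have "tg (tlog z x) (tlog z p) \<le> - l * tg \<phi> (tlog p z) - l * a * (dist z p)^2"
    using l by (simp add: right_diff_distrib mult.assoc)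
  then have 1: "(1 + 2 * l * a) * (dist z p)^2 + (dist z x)^2 \<le> (dist x p)^2 - 2 * l * tg \<phi> (tlog p z)"
    using tg_tlog_ge[OF H, of z x p] by (simp add: algebra_simps)
  have "tg \<phi> (tlog p x) - tg \<phi> (tlog p z) \<le> tnorm \<phi> * dist z x"
    using tg_tlog_lipschitz[OF H \<phi>(2), of x z] by (simp add: dist_commute)
  from mult_left_mono[OF this, of "2 * l"] 1 l show ?thesis by (simp add: algebra_simps)
qed

text \<open>The square of \<open>dist z x - l * tnorm \<phi>\<close> absorbs the error term, and the
  gain from strong monotonicity is dropped. The coefficient of the old squared distance stays
  exactly 1, as a supermartingale requires.\<close>

lemma resolvent_step_fejer:
  fixes x p :: "'a::polish_space"
  assumes H: "hadamard_space TYPE('a)" and B: "surjectivity_cond B" "monotone_vf B"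
    "strongly_monotone_vf B a" and l: "l > 0" and \<phi>: "\<phi> \<in> B p" "\<phi> \<in> tangent_space p"
    and z: "z = resolvent B l x"
  shows "(dist z p)^2 \<le> (dist x p)^2 - 2 * l * tg \<phi> (tlog p x) + l^2 * (tnorm \<phi>)^2"
proof -
  have "0 \<le> 2 * l * a * (dist z p)^2"
    using B(3) l by (simp add: strongly_monotone_vf_def)
  moreover have "0 \<le> (dist z x - l * tnorm \<phi>)^2" by simp
  ultimately show ?thesis
    using resolvent_step[OF assms] by (simp add: power2_diff power_mult_distrib algebra_simps)
qed

text \<open>With the old distance next to a, the expectation of their product will factor into past
  and sample.\<close>

lemma resolvent_step_contraction:
  fixes x p :: "'a::polish_space"
  assumes H: "hadamard_space TYPE('a)" and B: "surjectivity_cond B" "monotone_vf B"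
    "strongly_monotone_vf B a" and l: "l > 0" and \<phi>: "\<phi> \<in> B p" "\<phi> \<in> tangent_space p"
    and z: "z = resolvent B l x" and a: "a \<le> 1"
  shows "(dist z p)^2 + 2 * l * (a * (dist x p)^2) \<le> (dist x p)^2 - 2 * l * tg \<phi> (tlog p x)
      + l^2 * (2 * (tnorm \<phi>)^2 + 8 * (dist x p)^2)"
proof -
  define D h n e where "D = dist x p" and "h = dist z x" and "n = tnorm \<phi>" and "e = dist z p"
  have nn: "D \<ge> 0" "h \<ge> 0" "e \<ge> 0" by (auto simp: D_def h_def e_def)
  have a0: "a > 0" using B(3) by (simp add: strongly_monotone_vf_def)
  have "D \<le> e + h" unfolding D_def e_def h_def by metric
  \<comment> \<open>Strong monotonicity contracts the new distance e, which may depend on the sample; trading it for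
    the old distance D costs only second order in l, absorbed by \<open>- h^2\<close>.\<close>
  have "D^2 - 2 * D * h \<le> e^2"
  proof (cases "D \<le> h")
    case True
    then have "D * D \<le> D * h" using nn by (intro mult_left_mono)
    moreover have "0 \<le> D * h" "0 \<le> e^2" using nn by auto
    ultimately show ?thesis unfolding power2_eq_square[of D] by linarith
  next
    case False
    then have "(D - h)^2 \<le> e^2" using \<open>D \<le> e + h\<close> by (intro power_mono) auto
    then show ?thesis by (simp add: power2_diff) (smt (verit) zero_le_power2)
  qed
  then have "2 * l * a * (D^2 - 2 * D * h) \<le> 2 * l * a * e^2"
    using l a0 by (intro mult_left_mono) auto
  then have 1: "2 * l * (a * D^2) \<le> 2 * l * a * e^2 + 4 * l * (a * D) * h" by (simp add: algebra_simps)
  have 2: "(1 + 2 * l * a) * e^2 + h^2 \<le> D^2 - 2 * l * tg \<phi> (tlog p x) + 2 * l * n * h"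
    using resolvent_step[OF H B l \<phi> z] by (simp add: D_def h_def n_def e_def)
  \<comment> \<open>The single square \<open>h^2\<close> absorbs both terms linear in h: the error
    of the noise term and the price of returning to the old distance.\<close>
  have 3: "2 * l * n * h + 4 * l * (a * D) * h - h^2 \<le> l^2 * (n + 2 * (a * D))^2"
  proof -
    have "0 \<le> (h - l * (n + 2 * (a * D)))^2" by simp
    then have "2 * h * (l * (n + 2 * (a * D))) \<le> h^2 + l^2 * (n + 2 * (a * D))^2"
      by (simp add: power2_diff power_mult_distrib)
    then show ?thesis by (simp add: algebra_simps)
  qed
  \<comment> \<open>The coefficients 2 and 8 come from (u + v)^2 being at most 2 u^2 + 2 v^2 and
    from \<open>a \<le> 1\<close>.\<close>
  have "(n + 2 * (a * D))^2 \<le> 2 * n^2 + 8 * (a * D)^2"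
    using zero_le_power2[of "n - 2 * (a * D)"] by (simp add: power2_diff power2_sum power_mult_distrib mult_ac)
  also have "(a * D)^2 \<le> D^2" using a a0 nn by (intro power_mono) (auto simp: mult_left_le_one_le)
  finally have "l^2 * (n + 2 * (a * D))^2 \<le> l^2 * (2 * n^2 + 8 * D^2)"
    by (intro mult_left_mono) auto
  with 1 2 3 show ?thesis
    unfolding D_def[symmetric] h_def[symmetric] n_def[symmetric] e_def[symmetric]
    by (simp add: algebra_simps)
qed

section \<open>Random variables and supermartingales\<close>

text \<open>Simple functions approximating X take finitely many values, so the composition is
  patched from measurable pieces; continuity in the point passes to the limit.\<close>

lemma borel_measurable_caratheodory:
  fixes X :: "'w \<Rightarrow> 'a::{metric_space, second_countable_topology}"
    and f :: "'w \<Rightarrow> 'a \<Rightarrow> 'b::metric_space"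
  assumes X: "X \<in> borel_measurable M" and f: "\<And>x. (\<lambda>\<omega>. f \<omega> x) \<in> borel_measurable M"
    and cont: "\<And>\<omega>. \<omega> \<in> space M \<Longrightarrow> continuous_on UNIV (f \<omega>)"
  shows "(\<lambda>\<omega>. f \<omega> (X \<omega>)) \<in> borel_measurable M"
proof -
  obtain F where F: "\<And>i. simple_function M (F i)" "\<And>\<omega>. \<omega> \<in> space M \<Longrightarrow> (\<lambda>i. F i \<omega>) \<longlonglongrightarrow> X \<omega>"
    using borel_measurable_implies_sequence_metric[OF X, of undefined] by blast
  show ?thesis
  proof (rule borel_measurable_LIMSEQ_metric)
    fix i
    show "(\<lambda>\<omega>. f \<omega> (F i \<omega>)) \<in> borel_measurable M"
    proof (rule measurable_compose_countable'[where I = "F i ` space M" and g = "F i"])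
      show "F i \<in> measurable M (count_space (F i ` space M))"
        using F(1)[of i] by (simp add: measurable_simple_function simple_function_def measurable_count_space_eq2)
      show "countable (F i ` space M)" using F(1)[of i] by (simp add: simple_function_def countable_finite)
    qed (rule f)
  next
    fix \<omega> assume "\<omega> \<in> space M"
    then show "(\<lambda>i. f \<omega> (F i \<omega>)) \<longlonglongrightarrow> f \<omega> (X \<omega>)"
      using continuous_on_tendsto_compose[OF cont F(2)] by auto
  qed
qed

text \<open>Ville's inequality without conditional expectations: the supermartingale property is
  asked for only after integration over the events that the level has not been reached so
  far.\<close>

lemma (in prob_space) supermartingale_maximal_inequality:
  fixes U :: "nat \<Rightarrow> 'a \<Rightarrow> real"
  assumes int: "\<And>n. integrable M (U n)" and nn: "\<And>n \<omega>. 0 \<le> U n \<omega>" and e: "0 < e"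
    and step: "\<And>n. N \<le> n \<Longrightarrow>
      (\<integral>\<omega>. indicator {\<omega>\<in>space M. \<forall>i\<in>{N..n}. U i \<omega> < e} \<omega> * U (Suc n) \<omega> \<partial>M)
      \<le> (\<integral>\<omega>. indicator {\<omega>\<in>space M. \<forall>i\<in>{N..n}. U i \<omega> < e} \<omega> * U n \<omega> \<partial>M)"
  shows "prob {\<omega>\<in>space M. \<exists>n\<ge>N. e \<le> U n \<omega>} \<le> expectation (U N) / e"
proof -
  have [measurable]: "U n \<in> borel_measurable M" for n using int by (rule borel_measurable_integrable)
  define B where "B n = {\<omega>\<in>space M. \<forall>i\<in>{N..n}. U i \<omega> < e}" for n
  have [measurable]: "B n \<in> sets M" for n unfolding B_def by measurable
  have intB: "integrable M (\<lambda>\<omega>. indicator (B n) \<omega> * U m \<omega>)" for n m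
    using integrable_mult_indicator[OF _ int[of m], of "B n"] by simp
  \<comment> \<open>V n is the expectation at time n of U stopped, and capped at e, on first reaching e.\<close>
  define V where "V n = (\<integral>\<omega>. indicator (B n) \<omega> * U n \<omega> + e * indicator (space M - B n) \<omega> \<partial>M)" for n
  have intI: "integrable M (\<lambda>\<omega>. e * indicator (space M - B n) \<omega>)" for n
    by (intro integrable_mult_right integrable_real_indicator) (simp_all add: less_top[symmetric])
  have "V N \<le> expectation (U N)"
    unfolding V_def
  proof (rule integral_mono)
    show "indicator (B N) \<omega> * U N \<omega> + e * indicator (space M - B N) \<omega> \<le> U N \<omega>" if "\<omega> \<in> space M" for \<omega>
      using that by (auto simp: B_def indicator_def)
  qed (intro Bochner_Integration.integrable_add intB intI int)+
  have Vdec: "V (Suc n) \<le> V n" if "N \<le> n" for n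
  proof -
    have "V (Suc n) \<le> (\<integral>\<omega>. indicator (B n) \<omega> * U (Suc n) \<omega> + e * indicator (space M - B n) \<omega> \<partial>M)"
      unfolding V_def
    proof (rule integral_mono)
      fix \<omega> assume "\<omega> \<in> space M"
      \<comment> \<open>On \<open>B n\<close> outside \<open>B (Suc n)\<close> the level is reached
        just now, and e replaces a value that is at least e.\<close>
      moreover have "B (Suc n) = B n \<inter> {\<omega>\<in>space M. U (Suc n) \<omega> < e}"
        using that by (auto simp: B_def le_Suc_eq)
      ultimately show "indicator (B (Suc n)) \<omega> * U (Suc n) \<omega> + e * indicator (space M - B (Suc n)) \<omega>
          \<le> indicator (B n) \<omega> * U (Suc n) \<omega> + e * indicator (space M - B n) \<omega>"
        by (auto simp: indicator_def)
    qed (intro Bochner_Integration.integrable_add intB intI int)+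
    also have "\<dots> \<le> V n"
      unfolding V_def using step[OF that, folded B_def] intB intI by simp
    finally show ?thesis .
  qed
  have V: "V (N + k) \<le> expectation (U N)" for k
    using \<open>V N \<le> _\<close> by (induction k) (auto intro: order_trans[OF Vdec])
  have pB: "prob (space M - B (N + k)) \<le> expectation (U N) / e" for k
  proof -
    have "e * prob (space M - B (N + k)) = (\<integral>\<omega>. e * indicator (space M - B (N + k)) \<omega> \<partial>M)" by simp
    also have "\<dots> \<le> V (N + k)"
      unfolding V_def by (intro integral_mono intI Bochner_Integration.integrable_add intB) (simp add: nn)
    finally show ?thesis using V[of k] e by (simp add: pos_le_divide_eq mult.commute)
  qed
  have "(\<lambda>k. prob (space M - B (N + k))) \<longlonglongrightarrow> prob (\<Union>k. space M - B (N + k))"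
    by (rule finite_Lim_measure_incseq) (auto simp: incseq_def B_def)
  then have "prob (\<Union>k. space M - B (N + k)) \<le> expectation (U N) / e"
    by (rule LIMSEQ_le_const2) (use pB in auto)
  moreover have "(\<Union>k. space M - B (N + k)) = {\<omega>\<in>space M. \<exists>n\<ge>N. e \<le> U n \<omega>}"
  proof -
    have "\<exists>k. \<exists>i\<in>{N..N + k}. e \<le> U i \<omega>" if "N \<le> n" "e \<le> U n \<omega>" for n \<omega>
      using that by (intro exI[of _ "n - N"] bexI[of _ n]) auto
    then show ?thesis unfolding B_def by (fastforce simp: not_less)
  qed
  ultimately show ?thesis by simp
qed

section \<open>The stochastic proximal point iteration\<close>

text \<open>\<open>rec2\<close> bounds the weighted sum of the a n by D, so some a j with \<open>k \<le> j \<le> m\<close> is at most e/2;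
  \<open>rec1\<close> keeps all later terms below e.\<close>
lemma descent_rate:
  fixes a lam :: "nat \<Rightarrow> real"
  assumes a: "\<And>n. 0 \<le> a n" and lam: "\<And>n. 0 < lam n" and sq: "summable (\<lambda>n. (lam n)^2)"
    and c0: "0 \<le> c0" "c0 < c" and abar: "0 < abar" and b: "a 0 < b"
    and \<Lambda>: "(\<Sum>n. (lam n)^2) < \<Lambda>"
    and rec1: "\<And>n. a (Suc n) \<le> a n + (lam n)^2 * c0"
    and rec2: "\<And>n. a (Suc n) + 2 * lam n * (abar * a n) \<le> a n + (lam n)^2 * (2 * c0 + 8 * a n)"
    and D: "D = exp (2 * \<Lambda>) * (b + (4 * (b + 2 * \<Lambda> * c) + \<Lambda> * c)) / (2 * abar)"
    and e: "0 < e" and k: "(\<Sum>n. (lam (n + k))^2) < e / (2 * c)"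
    and m: "2 * D / e \<le> (\<Sum>n=k..m. lam n)" and n: "m \<le> n"
  shows "a n + c0 * (\<Sum>i. (lam (i + n))^2) < e"
proof -
  have sq_shift: "summable (\<lambda>i. (lam (i + j))^2)" for j using sq by (rule summable_ignore_initial_segment)
  have part: "(\<Sum>i<j. (lam i)^2) \<le> \<Lambda>" for j
    using sum_le_suminf[OF sq, of "{..<j}"] \<Lambda> by auto
  have \<Lambda>0: "0 < \<Lambda>" using suminf_nonneg[OF sq] \<Lambda> by fastforce
  have b0: "0 < b" using a[of 0] b by linarith
  have bound: "a j \<le> b + \<Lambda> * c" for j
  proof -
    have "a j \<le> a 0 + c0 * (\<Sum>i<j. (lam i)^2)"
    proof (induction j)
      case (Suc j)
      then show ?case using rec1[of j] by (simp add: algebra_simps)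
    qed simp
    also have "c0 * (\<Sum>i<j. (lam i)^2) \<le> c * \<Lambda>"
      using part[of j] c0 \<Lambda>0 by (intro mult_mono) (auto intro: sum_nonneg)
    finally show ?thesis using b by (simp add: mult.commute)
  qed
  \<comment> \<open>K majorises \<open>2 * c0 + 8 * a j\<close> for all j by the uniform
    \<open>bound\<close>, so the second-order terms of \<open>rec2\<close> add up to at most
    \<open>K * \<Lambda>\<close>.\<close>
  define K where "K = 2 * c + 8 * (b + \<Lambda> * c)"
  have weighted: "2 * abar * (\<Sum>i<j. lam i * a i) \<le> b + K * \<Lambda>" for j
  proof -
    have "a j + 2 * abar * (\<Sum>i<j. lam i * a i) \<le> a 0 + K * (\<Sum>i<j. (lam i)^2)"
    proof (induction j)
      case (Suc j)
      have "(lam j)^2 * (2 * c0 + 8 * a j) \<le> (lam j)^2 * K"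
        unfolding K_def using bound[of j] c0 by (intro mult_left_mono) auto
      then show ?case using Suc rec2[of j] by (simp add: algebra_simps)
    qed simp
    moreover have "K * (\<Sum>i<j. (lam i)^2) \<le> K * \<Lambda>"
      unfolding K_def using part[of j] c0 b0 \<Lambda>0 by (intro mult_left_mono) auto
    ultimately show ?thesis using a[of j] b by linarith
  qed
  \<comment> \<open>Termwise: b + 2 \<Lambda> c + 8 \<Lambda> b + 8 \<Lambda>^2 c against 5 b + 9
    \<Lambda> c + 10 \<Lambda> b + 18 \<Lambda>^2 c. The exponential in D then enters as an upper
    bound for 1 + 2 \<Lambda>.\<close>
  have "b + K * \<Lambda> \<le> (1 + 2 * \<Lambda>) * (b + (4 * (b + 2 * \<Lambda> * c) + \<Lambda> * c))"
  proof -
    have "0 \<le> \<Lambda> * b" "0 \<le> \<Lambda> * c" "0 \<le> \<Lambda> * (\<Lambda> * c)" using \<Lambda>0 b0 c0 by auto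
    then show ?thesis using b0 unfolding K_def by (simp add: algebra_simps)
  qed
  also have "\<dots> \<le> exp (2 * \<Lambda>) * (b + (4 * (b + 2 * \<Lambda> * c) + \<Lambda> * c))"
    using exp_ge_add_one_self[of "2 * \<Lambda>"] b0 \<Lambda>0 c0 by (intro mult_right_mono) auto
  also have "\<dots> = 2 * abar * D" using abar by (simp add: D)
  finally have sumD: "(\<Sum>i<j. lam i * a i) \<le> D" for j
    using weighted[of j] abar by (smt (verit) mult_le_cancel_left_pos)
  have D0: "0 < D" unfolding D using b0 \<Lambda>0 c0 abar
    by (intro divide_pos_pos mult_pos_pos add_pos_pos) auto
  have "\<exists>j\<in>{k..m}. a j \<le> e / 2"
  proof (rule ccontr)
    assume "\<not> ?thesis"
    then have *: "e / 2 < a j" if "j \<in> {k..m}" for j using that by force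
    \<comment> \<open>Strict comparison of the sums needs a nonempty range; an empty one would have
      weight zero, below the positive \<open>2 * D / e\<close>.\<close>
    have "{k..m} \<noteq> {}"
    proof
      assume "{k..m} = {}"
      then have "2 * D / e \<le> 0" using m by simp
      then show False using divide_pos_pos[of "2 * D" e] D0 e by linarith
    qed
    have "D = e / 2 * (2 * D / e)" using e by simp
    also have "\<dots> \<le> e / 2 * (\<Sum>j=k..m. lam j)" using m e by (intro mult_left_mono) auto
    also have "\<dots> = (\<Sum>j=k..m. lam j * (e / 2))" by (simp add: sum_distrib_left sum_distrib_right mult.commute)
    also have "\<dots> < (\<Sum>j=k..m. lam j * a j)"
      using * lam \<open>{k..m} \<noteq> {}\<close> by (intro sum_strict_mono mult_strict_left_mono) auto
    also have "\<dots> \<le> (\<Sum>j<Suc m. lam j * a j)"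
      by (intro sum_mono2) (auto intro: mult_nonneg_nonneg[OF less_imp_le[OF lam] a])
    also have "\<dots> \<le> D" by (rule sumD)
    finally show False by simp
  qed
  then obtain j where j: "k \<le> j" "j \<le> m" "a j \<le> e / 2" by auto
  have split: "(\<Sum>i. (lam (i + l))^2) = (lam l)^2 + (\<Sum>i. (lam (i + Suc l))^2)" for l
    using suminf_split_head[OF sq_shift[of l]] by simp
  \<comment> \<open>Adding the whole remaining allowance for increments makes the sequence
    nonincreasing.\<close>
  define U where "U l = a l + c0 * (\<Sum>i. (lam (i + l))^2)" for l
  have "U (Suc l) \<le> U l" for l
    using rec1[of l] split[of l] by (simp add: U_def algebra_simps)
  then have U: "U l' \<le> U l" if "l \<le> l'" for l l'
    using that by (rule lift_Suc_antimono_le)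
  have tail: "(\<Sum>i. (lam (i + j))^2) \<le> (\<Sum>i. (lam (i + k))^2)"
    using j(1)
  proof (rule lift_Suc_antimono_le[where f = "\<lambda>l. \<Sum>i. (lam (i + l))^2", rotated])
    show "(\<Sum>i. (lam (i + Suc l))^2) \<le> (\<Sum>i. (lam (i + l))^2)" for l
      using split[of l] by simp
  qed
  have "U n \<le> U j" using j n by (intro U) auto
  \<comment> \<open>One half of e comes from \<open>a j\<close>, the other from c times a tail below
    \<open>e / (2 * c)\<close>; hence the argument given to \<open>chi\<close> in the rate.\<close>
  also have "\<dots> \<le> e / 2 + c * (\<Sum>i. (lam (i + k))^2)"
    unfolding U_def using j tail c0 suminf_nonneg[OF sq_shift[of j]]
    by (intro add_mono mult_mono) auto
  also have "\<dots> < e / 2 + c * (e / (2 * c))"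
    using k c0 by (intro add_strict_left_mono mult_strict_left_mono) auto
  also have "\<dots> = e" using c0 by simp
  finally show ?thesis by (simp add: U_def)
qed

text \<open>Step n draws the sample \<open>\<xi> (Suc n)\<close>, so the past of step n is generated
  by the samples 1 to n, which is \<open>filtr P \<mu> \<xi> n\<close>.\<close>

locale random_ppa = prob_space P + E: prob_space \<mu>
  for P :: "'w measure" and \<mu> :: "'e measure" +
  fixes A :: "'e \<Rightarrow> 'a::polish_space \<Rightarrow> 'a tvec set"
    and \<alpha> :: "'e \<Rightarrow> real" and lam :: "nat \<Rightarrow> real" and \<xi> :: "nat \<Rightarrow> 'w \<Rightarrow> 'e"
    and x0 xs :: 'a and phis :: "'e \<Rightarrow> 'a tvec"
  assumes hadamard: "hadamard_space TYPE('a)"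
    and rmvf: "random_monotone_vf \<mu> A"
    and lam_pos: "0 < lam n"
    and lam_sq: "summable (\<lambda>n. (lam n)^2)"
    and lam_div: "filterlim (\<lambda>n. \<Sum>i<n. lam i) at_top sequentially"
    and xi_meas [measurable]: "\<xi> n \<in> measurable P \<mu>"
    and xi_indep: "indep_vars (\<lambda>_. \<mu>) (\<lambda>n. \<xi> (Suc n)) UNIV"
    and xi_distr: "distr P \<mu> (\<xi> (Suc n)) = \<mu>"
    and alpha_meas [measurable]: "\<alpha> \<in> borel_measurable \<mu>"
    and alpha_range: "s \<in> space \<mu> \<Longrightarrow> 0 < \<alpha> s \<and> \<alpha> s \<le> 1"
    and alpha_pos: "0 < (\<integral>s. \<alpha> s \<partial>\<mu>)"
    and strong: "s \<in> space \<mu> \<Longrightarrow> strongly_monotone_vf (A s) (\<alpha> s)"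
    and phis: "phis \<in> selections \<mu> A 2 xs"
    and centered: "AE \<omega> in P. real_cond_exp P (filtr P \<mu> \<xi> n)
               (\<lambda>\<omega>. tg (phis (\<xi> (Suc n) \<omega>)) (tlog xs (ppa_iter A lam \<xi> x0 n \<omega>))) \<omega> = 0"
begin

abbreviation X :: "nat \<Rightarrow> 'w \<Rightarrow> 'a" where "X \<equiv> ppa_iter A lam \<xi> x0"
abbreviation F :: "nat \<Rightarrow> 'w measure" where "F \<equiv> filtr P \<mu> \<xi>"
abbreviation sqd :: "nat \<Rightarrow> 'w \<Rightarrow> real" where "sqd n \<omega> \<equiv> (dist (X n \<omega>) xs)^2"
abbreviation noise :: "nat \<Rightarrow> 'w \<Rightarrow> real" where
  "noise n \<omega> \<equiv> tg (phis (\<xi> (Suc n) \<omega>)) (tlog xs (X n \<omega>))"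

definition second_moment :: real where "second_moment = (\<integral>s. (tnorm (phis s))^2 \<partial>\<mu>)"

lemma A_props:
  assumes "s \<in> space \<mu>"
  shows "monotone_vf (A s)" "surjectivity_cond (A s)" "A s x \<subseteq> tangent_space x"
  using rmvf assms by (auto simp: random_monotone_vf_def vector_field_def)

lemma phis_mem: "s \<in> space \<mu> \<Longrightarrow> phis s \<in> A s xs" "s \<in> space \<mu> \<Longrightarrow> phis s \<in> tangent_space xs"
  using phis A_props(3) by (auto simp: selections_def)

lemma phis_measurable [measurable]: "phis \<in> measurable \<mu> (tborel xs)"
  using phis by (simp add: selections_def)

lemma tnorm_phis_measurable [measurable]: "(\<lambda>s. tnorm (phis s)) \<in> borel_measurable \<mu>"
  using measurable_compose[OF phis_measurable tnorm_measurable[OF hadamard]] .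

lemma nn_integral_tnorm_phis: "(\<integral>\<^sup>+ s. ennreal ((tnorm (phis s))^2) \<partial>\<mu>) < \<infinity>"
proof -
  have "(\<integral>\<^sup>+ s. ennreal ((tnorm (phis s))^2) \<partial>\<mu>) = (\<integral>\<^sup>+ s. ennreal (tnorm (phis s) powr 2) \<partial>\<mu>)"
    using tangent_space_trep_of(3)[OF hadamard phis_mem(2)]
    by (intro nn_integral_cong) (simp add: powr_numeral)
  then show ?thesis using phis by (simp add: selections_def)
qed

lemma integrable_tnorm_phis: "integrable \<mu> (\<lambda>s. (tnorm (phis s))^2)"
  using nn_integral_tnorm_phis by (intro integrableI_nonneg) auto

lemma second_moment_nonneg: "0 \<le> second_moment"
  unfolding second_moment_def by (rule Bochner_Integration.integral_nonneg) simp

lemma nn_integral_second_moment: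
  "(\<integral>\<^sup>+ s. ennreal ((tnorm (phis s))^2) \<partial>\<mu>) = ennreal second_moment"
  unfolding second_moment_def by (rule nn_integral_eq_integral[OF integrable_tnorm_phis]) simp

lemma integrable_alpha: "integrable \<mu> \<alpha>"
proof (rule E.integrable_const_bound[of _ 1])
  show "AE s in \<mu>. norm (\<alpha> s) \<le> 1" using alpha_range by (intro AE_I2) force
qed measurable

section \<open>The filtration, measurability of the iterates and independence\<close>

lemma space_F [simp]: "space (F n) = space P"
  by (simp add: filtr_def space_measure_of_conv)

lemma sets_F: "sets (F n) = sigma_sets (space P) (\<Union>i\<in>{1..n}. {\<xi> i -` B \<inter> space P | B. B \<in> sets \<mu>})"
  unfolding filtr_def by (rule sets_measure_of) auto

lemma subalgebra_F: "subalgebra P (F n)"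
proof -
  have "sigma_sets (space P) (\<Union>i\<in>{1..n}. {\<xi> i -` B \<inter> space P | B. B \<in> sets \<mu>}) \<subseteq> sets P"
    by (rule sets.sigma_sets_subset) (use measurable_sets[OF xi_meas] in auto)
  then show ?thesis by (simp add: subalgebra_def sets_F)
qed

lemma measurable_F_Suc:
  assumes "h \<in> measurable (F n) N"
  shows "h \<in> measurable (F (Suc n)) N"
proof (rule measurable_from_subalg[OF _ assms])
  have "sets (F n) \<subseteq> sets (F (Suc n))" unfolding sets_F by (intro sigma_sets_mono') force
  then show "subalgebra (F (Suc n)) (F n)" by (simp add: subalgebra_def)
qed

lemma measurable_F_P: "h \<in> measurable (F n) N \<Longrightarrow> h \<in> measurable P N"
  by (rule measurable_from_subalg[OF subalgebra_F])

lemma xi_measurable_F: "\<xi> (Suc n) \<in> measurable (F (Suc n)) \<mu>"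
proof (rule measurableI)
  show "\<xi> (Suc n) \<omega> \<in> space \<mu>" if "\<omega> \<in> space (F (Suc n))" for \<omega>
    using that measurable_space[OF xi_meas] by simp
  show "\<xi> (Suc n) -` B \<inter> space (F (Suc n)) \<in> sets (F (Suc n))" if "B \<in> sets \<mu>" for B
    unfolding sets_F space_F using that by (intro sigma_sets.Basic) force
qed

text \<open>Resolvents are assumed measurable in the sample only for a fixed point; their continuity
  in the point allows the random point \<open>X n\<close> to be inserted.\<close>

lemma X_measurable_F: "X n \<in> borel_measurable (F n)"
proof (induction n)
  case (Suc n)
  have "(\<lambda>\<omega>. resolvent (A (\<xi> (Suc n) \<omega>)) (lam n) (X n \<omega>)) \<in> borel_measurable (F (Suc n))"
  proof (rule borel_measurable_caratheodory[where X = "X n"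
        and f = "\<lambda>\<omega>. resolvent (A (\<xi> (Suc n) \<omega>)) (lam n)"])
    show "X n \<in> borel_measurable (F (Suc n))" using Suc by (rule measurable_F_Suc)
    show "(\<lambda>\<omega>. resolvent (A (\<xi> (Suc n) \<omega>)) (lam n) x) \<in> borel_measurable (F (Suc n))" for x
      using rmvf lam_pos[of n] unfolding random_monotone_vf_def
      by (intro measurable_compose[OF xi_measurable_F]) auto
    show "continuous_on UNIV (resolvent (A (\<xi> (Suc n) \<omega>)) (lam n))" if "\<omega> \<in> space (F (Suc n))" for \<omega>
      using that measurable_space[OF xi_meas]
      by (intro resolvent_continuous hadamard A_props lam_pos) auto
  qed
  then show ?case by simp
qed simp

lemma X_measurable [measurable]: "X n \<in> borel_measurable P"
  using X_measurable_F by (rule measurable_F_P)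

lemma sqd_measurable_F: "sqd n \<in> borel_measurable (F n)"
  using X_measurable_F by measurable

lemma noise_measurable [measurable]: "noise n \<in> borel_measurable P"
proof (rule borel_measurable_caratheodory[where X = "X n" and f = "\<lambda>\<omega> x. tg (phis (\<xi> (Suc n) \<omega>)) (tlog xs x)"])
  show "(\<lambda>\<omega>. tg (phis (\<xi> (Suc n) \<omega>)) (tlog xs x)) \<in> borel_measurable P" for x
    using measurable_compose[OF measurable_compose[OF xi_meas phis_measurable]
        tg_measurable[OF hadamard tlog_in_tangent_space[OF hadamard]]] .
  show "continuous_on UNIV (\<lambda>x. tg (phis (\<xi> (Suc n) \<omega>)) (tlog xs x))" if "\<omega> \<in> space P" for \<omega>
  proof -
    let ?u = "phis (\<xi> (Suc n) \<omega>)"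
    have u: "?u \<in> tangent_space xs" using that measurable_space[OF xi_meas] by (intro phis_mem) auto
    have "(tnorm ?u)-lipschitz_on UNIV (\<lambda>x. tg ?u (tlog xs x))"
      using tg_tlog_lipschitz[OF hadamard u] tangent_space_trep_of(3)[OF hadamard u]
      by (intro lipschitz_onI) (auto simp: dist_real_def)
    then show ?thesis by (rule lipschitz_on_continuous_on)
  qed
qed measurable

text \<open>The independent samples are grouped into two disjoint blocks, the past and the next one;
  each block generates one of the two families.\<close>

lemma indep_set_F: "indep_set (sets (F n)) {\<xi> (Suc n) -` C \<inter> space P | C. C \<in> sets \<mu>}"
proof -
  define G where "G i = {\<xi> (Suc i) -` C \<inter> space P | C. C \<in> sets \<mu>}" for i
  define I where "I j = (if j then {..<n} else {n})" for j
  have "indep_sets G UNIV" using xi_indep by (simp add: indep_vars_def2 G_def[abs_def])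
  then have "indep_sets (\<lambda>j. sigma_sets (space P) (\<Union>i\<in>I j. G i)) UNIV"
  proof (intro indep_sets_collect_sigma)
    show "indep_sets G UNIV \<Longrightarrow> indep_sets G (\<Union>j\<in>UNIV. I j)" by (rule indep_sets_mono_index) auto
    show "Int_stable (G i)" for i
      unfolding G_def Int_stable_def by clarsimp (metis (no_types) Int_assoc inf.right_idem inf_commute sets.Int vimage_Int)
    show "disjoint_family_on I UNIV" by (auto simp: disjoint_family_on_def I_def)
  qed
  then show ?thesis
    unfolding indep_set_def
  proof (rule indep_sets_mono_sets)
    fix j :: bool
    \<comment> \<open>The filtration counts samples from 1, whereas \<open>G\<close> is indexed by
      predecessors.\<close>
    have "{1..n} = Suc ` {..<n}" by (simp add: image_Suc_lessThan)
    then have "sets (F n) = sigma_sets (space P) (\<Union>i\<in>{..<n}. G i)"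
      unfolding sets_F G_def by simp
    moreover have "G n \<subseteq> sigma_sets (space P) (G n)" by (rule sigma_sets_superset_generator)
    ultimately show "(case j of True \<Rightarrow> sets (F n) | False \<Rightarrow> {\<xi> (Suc n) -` C \<inter> space P | C. C \<in> sets \<mu>})
        \<subseteq> sigma_sets (space P) (\<Union>i\<in>I j. G i)"
      by (simp add: I_def G_def split: bool.split)
  qed
qed

text \<open>One variable generates a sub-sigma-algebra of the past, the other a sub-sigma-algebra of
  the pullback of \<mu> along the next sample.\<close>

lemma indep_var_F:
  assumes h: "h \<in> borel_measurable (F n)" and f: "f \<in> borel_measurable \<mu>"
  shows "indep_var borel h borel (\<lambda>\<omega>. f (\<xi> (Suc n) \<omega>))"
  unfolding indep_var_eq
proof (intro conjI)
  let ?V = "vimage_algebra (space P) (\<xi> (Suc n)) \<mu>"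
  have V: "sets ?V = {\<xi> (Suc n) -` C \<inter> space P | C. C \<in> sets \<mu>}"
    using measurable_space[OF xi_meas] by (intro sets_vimage_algebra2) auto
  show "random_variable borel h" using h by (rule measurable_F_P)
  show "random_variable borel (\<lambda>\<omega>. f (\<xi> (Suc n) \<omega>))" using f by measurable
  have "{h -` B \<inter> space P |B. B \<in> sets borel} \<subseteq> sets (F n)"
    using measurable_sets[OF h] by auto
  from sets.sigma_sets_subset[OF this]
  have 1: "sigma_sets (space P) {h -` B \<inter> space P |B. B \<in> sets borel} \<subseteq> sets (F n)" by simp
  have fV: "(\<lambda>\<omega>. f (\<xi> (Suc n) \<omega>)) \<in> borel_measurable ?V"
    using measurable_space[OF xi_meas]
    by (intro measurable_compose[OF measurable_vimage_algebra1 f]) auto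
  have "{(\<lambda>\<omega>. f (\<xi> (Suc n) \<omega>)) -` B \<inter> space P |B. B \<in> sets borel} \<subseteq> sets ?V"
    using measurable_sets[OF fV] by (auto simp del: sets_vimage_algebra)
  from sets.sigma_sets_subset[OF this]
  have 2: "sigma_sets (space P) {(\<lambda>\<omega>. f (\<xi> (Suc n) \<omega>)) -` B \<inter> space P |B. B \<in> sets borel} \<subseteq> sets ?V"
    by simp
  show "indep_set (sigma_sets (space P) {h -` B \<inter> space P |B. B \<in> sets borel})
     (sigma_sets (space P) {(\<lambda>\<omega>. f (\<xi> (Suc n) \<omega>)) -` B \<inter> space P |B. B \<in> sets borel})"
    using indep_set_F[of n] 1 2 unfolding V[symmetric] indep_sets2_eq by blast
qed

lemma integrable_xi:
  fixes f :: "'e \<Rightarrow> real"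
  assumes "integrable \<mu> f"
  shows "integrable P (\<lambda>\<omega>. f (\<xi> (Suc n) \<omega>))"
  using assms by (subst (asm) xi_distr[of n, symmetric]) (rule integrable_distr[OF xi_meas])

lemma integral_xi:
  fixes f :: "'e \<Rightarrow> real"
  assumes "f \<in> borel_measurable \<mu>"
  shows "(\<integral>\<omega>. f (\<xi> (Suc n) \<omega>) \<partial>P) = (\<integral>s. f s \<partial>\<mu>)"
  using integral_distr[OF xi_meas[of "Suc n"] assms] by (simp add: xi_distr)

lemma integral_product:
  fixes f :: "'e \<Rightarrow> real"
  assumes h: "h \<in> borel_measurable (F n)" "integrable P h" and f: "integrable \<mu> f"
  shows "(\<integral>\<omega>. h \<omega> * f (\<xi> (Suc n) \<omega>) \<partial>P) = (\<integral>\<omega>. h \<omega> \<partial>P) * (\<integral>s. f s \<partial>\<mu>)"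
    and "integrable P (\<lambda>\<omega>. h \<omega> * f (\<xi> (Suc n) \<omega>))"
proof -
  have "f \<in> borel_measurable \<mu>" using f by (rule borel_measurable_integrable)
  note iv = indep_var_F[OF h(1) this] h(2) integrable_xi[OF f]
  show "integrable P (\<lambda>\<omega>. h \<omega> * f (\<xi> (Suc n) \<omega>))" by (rule indep_var_integrable[OF iv])
  show "(\<integral>\<omega>. h \<omega> * f (\<xi> (Suc n) \<omega>) \<partial>P) = (\<integral>\<omega>. h \<omega> \<partial>P) * (\<integral>s. f s \<partial>\<mu>)"
    using indep_var_lebesgue_integral[OF iv] by (simp add: integral_xi[OF \<open>f \<in> _\<close>])
qed

lemma integral_xi_tnorm: "expectation (\<lambda>\<omega>. (tnorm (phis (\<xi> (Suc n) \<omega>)))^2) = second_moment"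
  unfolding second_moment_def by (rule integral_xi[of "\<lambda>s. (tnorm (phis s))^2"]) measurable

section \<open>One-step inequalities along the iteration and in expectation\<close>

lemma step_fejer:
  assumes "\<omega> \<in> space P"
  shows "sqd (Suc n) \<omega> \<le> sqd n \<omega> - 2 * lam n * noise n \<omega> + (lam n)^2 * (tnorm (phis (\<xi> (Suc n) \<omega>)))^2"
proof -
  have s: "\<xi> (Suc n) \<omega> \<in> space \<mu>" using assms measurable_space[OF xi_meas] by auto
  show ?thesis
    using resolvent_step_fejer[OF hadamard A_props(2)[OF s] A_props(1)[OF s] strong[OF s] lam_pos[of n]
        phis_mem(1)[OF s] phis_mem(2)[OF s] refl, of "X n \<omega>"] by simp
qed

lemma step_contraction:
  assumes "\<omega> \<in> space P"
  shows "sqd (Suc n) \<omega> + 2 * lam n * (\<alpha> (\<xi> (Suc n) \<omega>) * sqd n \<omega>) \<le> sqd n \<omega> - 2 * lam n * noise n \<omega>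
    + (lam n)^2 * (2 * (tnorm (phis (\<xi> (Suc n) \<omega>)))^2 + 8 * sqd n \<omega>)"
proof -
  have s: "\<xi> (Suc n) \<omega> \<in> space \<mu>" using assms measurable_space[OF xi_meas] by auto
  show ?thesis
    using resolvent_step_contraction[OF hadamard A_props(2)[OF s] A_props(1)[OF s] strong[OF s] lam_pos[of n]
        phis_mem(1)[OF s] phis_mem(2)[OF s] refl conjunct2[OF alpha_range[OF s]], of "X n \<omega>"] by simp
qed

text \<open>Cauchy-Schwarz and the inequality of arithmetic and geometric means bound the noise by
  integrable terms; this serves its integrability.\<close>

lemma abs_noise_le:
  assumes "\<omega> \<in> space P"
  shows "2 * \<bar>noise n \<omega>\<bar> \<le> (tnorm (phis (\<xi> (Suc n) \<omega>)))^2 + sqd n \<omega>"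
proof -
  have "phis (\<xi> (Suc n) \<omega>) \<in> tangent_space xs"
    using assms measurable_space[OF xi_meas] by (intro phis_mem) auto
  from abs_tg_le[OF hadamard this tlog_in_tangent_space[OF hadamard, of xs "X n \<omega>"]]
  have "\<bar>noise n \<omega>\<bar> \<le> tnorm (phis (\<xi> (Suc n) \<omega>)) * dist (X n \<omega>) xs"
    by (simp add: tnorm_tlog[OF hadamard] dist_commute)
  moreover have "0 \<le> (tnorm (phis (\<xi> (Suc n) \<omega>)) - dist (X n \<omega>) xs)^2" by simp
  ultimately show ?thesis by (simp add: power2_diff)
qed

lemma integrable_noise_of_sqd:
  assumes "integrable P (sqd n)"
  shows "integrable P (noise n)"
proof (rule Bochner_Integration.integrable_bound)
  show "integrable P (\<lambda>\<omega>. (tnorm (phis (\<xi> (Suc n) \<omega>)))^2 + sqd n \<omega>)"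
    by (intro Bochner_Integration.integrable_add assms integrable_xi[OF integrable_tnorm_phis])
  show "AE \<omega> in P. norm (noise n \<omega>) \<le> norm ((tnorm (phis (\<xi> (Suc n) \<omega>)))^2 + sqd n \<omega>)"
  proof (rule AE_I2)
    fix \<omega> assume "\<omega> \<in> space P"
    from abs_noise_le[OF this, of n]
    show "norm (noise n \<omega>) \<le> norm ((tnorm (phis (\<xi> (Suc n) \<omega>)))^2 + sqd n \<omega>)"
      unfolding real_norm_def by linarith
  qed
qed measurable

text \<open>By induction: the descent inequality dominates the next squared distance by terms that
  are integrable once the current squared distance is.\<close>

lemma integrable_sqd: "integrable P (sqd n)"
proof (induction n)
  case (Suc n)
  show ?case
  proof (rule Bochner_Integration.integrable_bound)
    show "integrable P (\<lambda>\<omega>. sqd n \<omega> - 2 * lam n * noise n \<omega> + (lam n)^2 * (tnorm (phis (\<xi> (Suc n) \<omega>)))^2)"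
      by (intro Bochner_Integration.integrable_add Bochner_Integration.integrable_diff integrable_mult_right
          Suc integrable_noise_of_sqd integrable_xi[OF integrable_tnorm_phis])
    show "AE \<omega> in P. norm (sqd (Suc n) \<omega>)
        \<le> norm (sqd n \<omega> - 2 * lam n * noise n \<omega> + (lam n)^2 * (tnorm (phis (\<xi> (Suc n) \<omega>)))^2)"
      using step_fejer[of _ n] by (intro AE_I2) fastforce
  qed measurable
qed simp

lemma integrable_noise: "integrable P (noise n)"
  using integrable_sqd by (rule integrable_noise_of_sqd)

text \<open>(A3) integrated over an event of the past. The whole space gives mean zero, and the
  event of not yet having reached a level is what the maximal inequality needs.\<close>

lemma integral_noise:
  assumes B: "B \<in> sets (F n)"
  shows "(\<integral>\<omega>. indicator B \<omega> * noise n \<omega> \<partial>P) = 0"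
proof -
  interpret S: sigma_finite_subalgebra P "F n"
    by (intro finite_measure_subalgebra_is_sigma_finite finite_measure_subalgebra.intro
        finite_measure_subalgebra_axioms.intro subalgebra_F) unfold_locales
  have "(\<integral>\<omega>\<in>B. noise n \<omega> \<partial>P) = (\<integral>\<omega>\<in>B. real_cond_exp P (F n) (noise n) \<omega> \<partial>P)"
    by (rule S.real_cond_exp_intA[OF integrable_noise B])
  also have "\<dots> = 0"
    unfolding set_lebesgue_integral_def using centered[of n] by (intro integral_eq_zero_AE) auto
  finally show ?thesis by (simp add: set_lebesgue_integral_def)
qed

text \<open>The norm of \<open>phis\<close> at the next sample is independent of B, so its square
  integrates over B to \<open>second_moment * prob B\<close>. The factor \<open>prob B\<close> later
  lets the increment cancel against the tail correction on B.\<close>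

lemma integral_step_fejer:
  assumes B: "B \<in> sets (F n)"
  shows "(\<integral>\<omega>. indicator B \<omega> * sqd (Suc n) \<omega> \<partial>P)
    \<le> (\<integral>\<omega>. indicator B \<omega> * sqd n \<omega> \<partial>P) + (lam n)^2 * second_moment * prob B"
proof -
  have BP: "B \<in> sets P" using B subalgebra_F by (auto simp: subalgebra_def)
  have ind: "integrable P (\<lambda>\<omega>. indicator B \<omega> * f \<omega>)" if "integrable P f" for f :: "'w \<Rightarrow> real"
    using integrable_mult_indicator[OF BP that] by simp
  note prod = integral_product[of "indicator B" n, OF _ _ integrable_tnorm_phis]
  have B1: "indicator B \<in> borel_measurable (F n)" "integrable P (indicator B :: 'w \<Rightarrow> real)"
    using B BP by (auto intro!: integrable_real_indicator simp: less_top[symmetric])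
  have "(\<integral>\<omega>. indicator B \<omega> * sqd (Suc n) \<omega> \<partial>P) \<le> (\<integral>\<omega>. indicator B \<omega> * sqd n \<omega>
      - 2 * lam n * (indicator B \<omega> * noise n \<omega>)
      + (lam n)^2 * (indicator B \<omega> * (tnorm (phis (\<xi> (Suc n) \<omega>)))^2) \<partial>P)"
    using step_fejer
    by (intro integral_mono Bochner_Integration.integrable_add Bochner_Integration.integrable_diff
        integrable_mult_right ind integrable_sqd integrable_noise integrable_xi[OF integrable_tnorm_phis])
      (auto simp: indicator_def)
  also have "\<dots> = (\<integral>\<omega>. indicator B \<omega> * sqd n \<omega> \<partial>P) - 2 * lam n * (\<integral>\<omega>. indicator B \<omega> * noise n \<omega> \<partial>P)
      + (lam n)^2 * (\<integral>\<omega>. indicator B \<omega> * (tnorm (phis (\<xi> (Suc n) \<omega>)))^2 \<partial>P)"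
    by (simp add: ind integrable_sqd integrable_noise integrable_xi[OF integrable_tnorm_phis]
        del: ppa_iter.simps)
  also have "\<dots> = (\<integral>\<omega>. indicator B \<omega> * sqd n \<omega> \<partial>P) + (lam n)^2 * second_moment * prob B"
    using prod(1)[OF B1] BP integral_noise[OF B] by (simp add: second_moment_def mult_ac)
  finally show ?thesis .
qed

lemma expectation_step_fejer:
  "expectation (sqd (Suc n)) \<le> expectation (sqd n) + (lam n)^2 * second_moment"
proof -
  have eq: "(\<integral>\<omega>. indicator (space P) \<omega> * f \<omega> \<partial>P) = (\<integral>\<omega>. f \<omega> \<partial>P)" for f :: "'w \<Rightarrow> real"
    by (intro Bochner_Integration.integral_cong) auto
  have "space P \<in> sets (F n)" using sets.top[of "F n"] by simp
  from integral_step_fejer[OF this] show ?thesis by (simp add: eq prob_space del: ppa_iter.simps)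
qed

text \<open>The current squared distance belongs to the past and \<alpha> is evaluated at the next
  sample, so the mean of their product is the product of the means.\<close>

lemma expectation_step_contraction:
  "expectation (sqd (Suc n)) + 2 * lam n * ((\<integral>s. \<alpha> s \<partial>\<mu>) * expectation (sqd n))
    \<le> expectation (sqd n) + (lam n)^2 * (2 * second_moment + 8 * expectation (sqd n))"
proof -
  note prod = integral_product[OF sqd_measurable_F integrable_sqd integrable_alpha, of n]
  note ints = integrable_sqd integrable_noise integrable_xi[OF integrable_tnorm_phis] prod(2)
  have noise0: "expectation (noise n) = 0"
  proof -
    have "space P \<in> sets (F n)" using sets.top[of "F n"] by simp
    from integral_noise[OF this] show ?thesis
      by (metis (no_types, lifting) Bochner_Integration.integral_cong indicator_eq_1_iff mult_1)
  qed
  have "expectation (\<lambda>\<omega>. sqd (Suc n) \<omega> + 2 * lam n * (sqd n \<omega> * \<alpha> (\<xi> (Suc n) \<omega>)))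
    \<le> expectation (\<lambda>\<omega>. sqd n \<omega> - 2 * lam n * noise n \<omega>
      + (lam n)^2 * (2 * (tnorm (phis (\<xi> (Suc n) \<omega>)))^2 + 8 * sqd n \<omega>))"
    using step_contraction
    by (intro integral_mono Bochner_Integration.integrable_add Bochner_Integration.integrable_diff
        integrable_mult_right ints) (simp add: mult_ac del: ppa_iter.simps)
  also have "\<dots> = expectation (sqd n) - 2 * lam n * expectation (noise n)
      + (lam n)^2 * (2 * second_moment + 8 * expectation (sqd n))"
    by (simp add: ints integral_xi_tnorm del: ppa_iter.simps)
  also have "expectation (\<lambda>\<omega>. sqd (Suc n) \<omega> + 2 * lam n * (sqd n \<omega> * \<alpha> (\<xi> (Suc n) \<omega>)))
      = expectation (sqd (Suc n)) + 2 * lam n * (expectation (sqd n) * (\<integral>s. \<alpha> s \<partial>\<mu>))"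
    by (simp add: ints prod(1) del: ppa_iter.simps)
  finally show ?thesis
    by (simp add: noise0 mult_ac del: ppa_iter.simps)
qed

section \<open>The tail-corrected supermartingale\<close>

definition tail :: "nat \<Rightarrow> real" where "tail n = (\<Sum>i. (lam (i + n))^2)"

lemma summable_tail: "summable (\<lambda>i. (lam (i + n))^2)"
  using lam_sq by (rule summable_ignore_initial_segment)

lemma tail_nonneg: "0 \<le> tail n"
  unfolding tail_def by (rule suminf_nonneg[OF summable_tail]) simp

lemma tail_split: "tail n = (lam n)^2 + tail (Suc n)"
  using suminf_split_head[OF summable_tail[of n]] by (simp add: tail_def)

lemma measurable_F_mono: "i \<le> n \<Longrightarrow> h \<in> measurable (F i) N \<Longrightarrow> h \<in> measurable (F n) N"
  by (induction rule: dec_induct) (auto intro: measurable_F_Suc)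

text \<open>The maximal inequality is applied to the squared distance plus its tail correction,
  which dominates the squared distance and whose mean at time N is the assumed quantity.\<close>

lemma prob_tail_less:
  assumes e: "0 < e" and bound: "expectation (sqd N) + second_moment * tail N < l * e"
  shows "prob {\<omega>\<in>space P. \<exists>n\<ge>N. e \<le> sqd n \<omega>} < l"
proof -
  define U where "U n \<omega> = sqd n \<omega> + second_moment * tail n" for n \<omega>
  have U0: "sqd n \<omega> \<le> U n \<omega>" for n \<omega>
    unfolding U_def using second_moment_nonneg tail_nonneg by simp
  have int: "integrable P (U n)" for n
    unfolding U_def by (intro Bochner_Integration.integrable_add integrable_sqd) simp
  have [measurable]: "U n \<in> borel_measurable P" for n using int by (rule borel_measurable_integrable)
  have "prob {\<omega>\<in>space P. \<exists>n\<ge>N. e \<le> U n \<omega>} \<le> expectation (U N) / e"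
  proof (rule supermartingale_maximal_inequality[OF int _ e])
    show "0 \<le> U n \<omega>" for n \<omega> using U0[of n \<omega>] zero_le_power2[of "dist (X n \<omega>) xs"] by linarith
    fix n assume "N \<le> n"
    define B where "B = {\<omega>\<in>space P. \<forall>i\<in>{N..n}. U i \<omega> < e}"
    have "U i \<in> borel_measurable (F n)" if "i \<in> {N..n}" for i
    proof -
      have "sqd i \<in> borel_measurable (F n)"
        using measurable_F_mono[OF _ sqd_measurable_F] that by simp
      then show ?thesis unfolding U_def by measurable
    qed
    then have "{\<omega>\<in>space (F n). \<forall>i\<in>{N..n}. U i \<omega> < e} \<in> sets (F n)"
      by (intro sets.sets_Collect_finite_All borel_measurable_less) auto
    then have B: "B \<in> sets (F n)" by (simp add: B_def)
    then have BP: "B \<in> sets P" using subalgebra_F by (auto simp: subalgebra_def)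
    have split: "(\<integral>\<omega>. indicator B \<omega> * U m \<omega> \<partial>P)
        = (\<integral>\<omega>. indicator B \<omega> * sqd m \<omega> \<partial>P) + second_moment * tail m * prob B" for m
    proof -
      have "integrable P (\<lambda>\<omega>. indicator B \<omega> * sqd m \<omega>)"
        using integrable_mult_indicator[OF BP integrable_sqd[of m]] by simp
      moreover have "integrable P (indicator B :: 'w \<Rightarrow> real)"
        using BP by (auto intro!: integrable_real_indicator simp: less_top[symmetric])
      ultimately show ?thesis
        using BP by (simp add: U_def distrib_left mult.commute[of "indicator B _"])
    qed
    \<comment> \<open>On B the correction loses exactly the increment allowed by the descent
      inequality.\<close>
    have "(\<integral>\<omega>. indicator B \<omega> * U (Suc n) \<omega> \<partial>P) \<le> (\<integral>\<omega>. indicator B \<omega> * U n \<omega> \<partial>P)"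
      using integral_step_fejer[OF B] unfolding split tail_split[of n] by (simp add: algebra_simps)
    then show "(\<integral>\<omega>. indicator {\<omega>\<in>space P. \<forall>i\<in>{N..n}. U i \<omega> < e} \<omega> * U (Suc n) \<omega> \<partial>P)
      \<le> (\<integral>\<omega>. indicator {\<omega>\<in>space P. \<forall>i\<in>{N..n}. U i \<omega> < e} \<omega> * U n \<omega> \<partial>P)"
      by (simp add: B_def)
  qed
  moreover have "prob {\<omega>\<in>space P. \<exists>n\<ge>N. e \<le> sqd n \<omega>} \<le> prob {\<omega>\<in>space P. \<exists>n\<ge>N. e \<le> U n \<omega>}"
    by (rule finite_measure_mono) (use U0 in \<open>auto intro: order_trans\<close>, measurable)
  moreover have "expectation (U N) = expectation (sqd N) + second_moment * tail N"
    unfolding U_def by (simp add: integrable_sqd prob_space)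
  ultimately have "prob {\<omega>\<in>space P. \<exists>n\<ge>N. e \<le> sqd n \<omega>} \<le> (expectation (sqd N) + second_moment * tail N) / e"
    by simp
  also have "\<dots> < l" using bound e by (simp add: pos_divide_less_eq)
  finally show ?thesis .
qed

section \<open>Rates and convergence\<close>

lemma nn_integral_sqd: "(\<integral>\<^sup>+ \<omega>. ennreal (sqd n \<omega>) \<partial>P) = ennreal (expectation (sqd n))"
  by (rule nn_integral_eq_integral[OF integrable_sqd]) simp

lemma expectation_sqd_nonneg: "0 \<le> expectation (sqd n)"
  by (rule Bochner_Integration.integral_nonneg) simp

text \<open>The starting point is deterministic, so b only has to exceed
  \<open>(dist x0 xs)^2\<close>. The tail term is kept in the conclusion because
  \<open>prob_tail_less\<close> consumes the sum.\<close>

lemma rate: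
  assumes chi: "\<forall>\<epsilon>>0. (\<Sum>n. (lam (n + chi \<epsilon>))^2) < \<epsilon>"
    and theta: "\<forall>b'>0. \<forall>k. (\<Sum>n=k..theta k b'. lam n) \<ge> b'"
    and \<Lambda>: "(\<Sum>n. (lam n)^2) < \<Lambda>" and c: "0 < c" "second_moment < c"
    and b: "(dist x0 xs)^2 < b"
    and D: "D = exp (2 * \<Lambda>) * (b + (4 * (b + 2 * \<Lambda> * c) + \<Lambda> * c)) / (2 * (\<integral>s. \<alpha> s \<partial>\<mu>))"
    and e: "0 < e" and n: "theta (chi (e / (2 * c))) (2 * D / e) \<le> n"
  shows "expectation (sqd n) + second_moment * tail n < e"
proof -
  have a0: "expectation (sqd 0) < b" using b by (simp add: prob_space)
  have "0 < b" using b zero_le_power2[of "dist x0 xs"] by linarith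
  moreover have "0 < \<Lambda>" using \<Lambda> suminf_nonneg[OF lam_sq] by fastforce
  ultimately have "0 < D" unfolding D using c alpha_pos
    by (intro divide_pos_pos mult_pos_pos add_pos_pos) auto
  show ?thesis
    unfolding tail_def
  proof (rule descent_rate[OF expectation_sqd_nonneg lam_pos lam_sq second_moment_nonneg c(2) alpha_pos
        a0 \<Lambda> expectation_step_fejer expectation_step_contraction D e _ _ n])
    show "(\<Sum>n. (lam (n + chi (e / (2 * c))))^2) < e / (2 * c)" using chi e c by simp
    show "2 * D / e \<le> (\<Sum>n=chi (e / (2 * c))..theta (chi (e / (2 * c))) (2 * D / e). lam n)"
      using theta e \<open>0 < D\<close> by simp
  qed
qed

text \<open>Summability and divergence provide some pair of moduli, so both limit statements follow
  from the quantitative one.\<close>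

lemma eventually_small:
  assumes e: "0 < e"
  shows "\<exists>N. \<forall>n\<ge>N. expectation (sqd n) + second_moment * tail n < e"
proof -
  have "\<exists>N. (\<Sum>n. (lam (n + N))^2) < \<epsilon>" if "\<epsilon> > 0" for \<epsilon>
    using suminf_exist_split[OF that lam_sq] by (metis abs_ge_self le_less_trans order_refl real_norm_def)
  then obtain chi where chi: "\<forall>\<epsilon>>0. (\<Sum>n. (lam (n + chi \<epsilon>))^2) < \<epsilon>" by metis
  have ex: "\<exists>m. (\<Sum>n=k..m. lam n) \<ge> b'" for k b'
  proof -
    obtain m where m: "k \<le> m" "b' + (\<Sum>i<k. lam i) \<le> (\<Sum>i<m. lam i)"
      \<comment> \<open>Divergence is an eventual statement, so m may be taken beyond k; the target
        is raised by the initial sum that is split off next.\<close>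
      using lam_div unfolding filterlim_at_top eventually_sequentially by (meson linear order_trans)
    have "(\<Sum>i<m. lam i) = (\<Sum>i<k. lam i) + (\<Sum>i\<in>{k..<m}. lam i)"
      using m(1) by (metis atLeast0LessThan sum.atLeastLessThan_concat zero_le)
    also have "(\<Sum>i\<in>{k..<m}. lam i) \<le> (\<Sum>i=k..m. lam i)"
      by (intro sum_mono2) (auto intro: less_imp_le[OF lam_pos])
    finally show ?thesis using m(2) by (intro exI[of _ m]) linarith
  qed
  define theta where "theta k b' = (SOME m. (\<Sum>n=k..m. lam n) \<ge> b')" for k b'
  have theta: "\<forall>b'>0. \<forall>k. (\<Sum>n=k..theta k b'. lam n) \<ge> b'"
    unfolding theta_def using someI_ex[OF ex] by blast
  \<comment> \<open>Adding 1 to each of the three quantities gives the strict bounds that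
    \<open>rate\<close> requires.\<close>
  show ?thesis
    using rate[OF chi theta _ _ _ _ refl e, of "(\<Sum>n. (lam n)^2) + 1" "second_moment + 1" "(dist x0 xs)^2 + 1"]
      second_moment_nonneg by auto
qed

lemma expectation_tendsto: "(\<lambda>n. expectation (sqd n)) \<longlonglongrightarrow> 0"
proof (rule LIMSEQ_I)
  fix e :: real assume "0 < e"
  then obtain N where "\<forall>n\<ge>N. expectation (sqd n) + second_moment * tail n < e"
    using eventually_small by blast
  then show "\<exists>N. \<forall>n\<ge>N. norm (expectation (sqd n) - 0) < e"
    using expectation_sqd_nonneg second_moment_nonneg tail_nonneg
    by (intro exI[of _ N]) (smt (verit) mult_nonneg_nonneg real_norm_def)
qed

text \<open>For fixed e, the event that e is reached infinitely often has probability below every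
  positive l by the tail bound, hence is null; countably many values of e suffice.\<close>

lemma AE_tendsto: "AE \<omega> in P. (\<lambda>n. sqd n \<omega>) \<longlonglongrightarrow> 0"
proof -
  have "AE \<omega> in P. \<exists>N. \<forall>n\<ge>N. sqd n \<omega> < e" if e: "0 < e" for e
  proof -
    define S where "S = {\<omega>\<in>space P. \<forall>N. \<exists>n\<ge>N. e \<le> sqd n \<omega>}"
    have S: "S \<in> sets P" unfolding S_def by measurable
    have "prob S \<le> l" if l: "0 < l" for l
    proof -
      obtain N where "expectation (sqd N) + second_moment * tail N < l * e"
        using eventually_small[of "l * e"] l e by auto
      from prob_tail_less[OF e this]
      have "prob {\<omega>\<in>space P. \<exists>n\<ge>N. e \<le> sqd n \<omega>} < l" .
      moreover have "prob S \<le> prob {\<omega>\<in>space P. \<exists>n\<ge>N. e \<le> sqd n \<omega>}"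
        by (rule finite_measure_mono) (auto simp: S_def)
      ultimately show ?thesis by simp
    qed
    then have "prob S \<le> 0" by (rule field_le_epsilon[of _ 0, simplified])
    then have "emeasure P S = 0" by (simp add: emeasure_eq_measure measure_le_0_iff)
    then have "AE \<omega> in P. \<omega> \<notin> S" using S by (intro AE_not_in) (auto simp: null_sets_def)
    then show ?thesis
    proof (rule AE_mp, intro AE_I2 impI)
      fix \<omega> assume "\<omega> \<in> space P" "\<omega> \<notin> S"
      then show "\<exists>N. \<forall>n\<ge>N. sqd n \<omega> < e" unfolding S_def by (force simp: not_le)
    qed
  qed
  then have "AE \<omega> in P. \<forall>k. \<exists>N. \<forall>n\<ge>N. sqd n \<omega> < inverse (real (Suc k))"
    by (subst AE_all_countable) simp
  then show ?thesis
  proof (rule AE_mp, intro AE_I2 impI LIMSEQ_I)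
    fix \<omega> and r :: real
    assume *: "\<forall>k. \<exists>N. \<forall>n\<ge>N. sqd n \<omega> < inverse (real (Suc k))" and "0 < r"
    then obtain k where "inverse (real (Suc k)) < r" using reals_Archimedean by blast
    with * obtain N where "\<forall>n\<ge>N. sqd n \<omega> < r" by (meson less_trans)
    then show "\<exists>N. \<forall>n\<ge>N. norm (sqd n \<omega> - 0) < r" by auto
  qed
qed

end

theorem mainTheorem9:
  fixes \<mu> :: "'e measure" and P :: "'w measure"
    and A :: "'e \<Rightarrow> 'a::polish_space \<Rightarrow> 'a tvec set"
    and \<alpha> :: "'e \<Rightarrow> real" and lam :: "nat \<Rightarrow> real" and \<xi> :: "nat \<Rightarrow> 'w \<Rightarrow> 'e"
    and x0 xs :: 'a and phis :: "'e \<Rightarrow> 'a tvec"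
  assumes hadamard: "hadamard_space TYPE('a)"
    and sepT: "\<forall>x::'a. tangent_separable x"
    and probE: "prob_space \<mu>" and probO: "prob_space P"
    and rmvf: "random_monotone_vf \<mu> A"
    and lam_pos: "\<forall>n. 0 < lam n"
    \<comment> \<open>(A0)\<close>
    and A0_sq: "summable (\<lambda>n. (lam n)^2)"
    and A0_div: "filterlim (\<lambda>n. \<Sum>i<n. lam i) at_top sequentially"
    and A0_meas: "\<forall>n. \<xi> n \<in> measurable P \<mu>"
    and A0_indep: "prob_space.indep_vars P (\<lambda>_. \<mu>) (\<lambda>n. \<xi> (Suc n)) UNIV"
    and A0_distr: "\<forall>n. distr P \<mu> (\<xi> (Suc n)) = \<mu>"
    \<comment> \<open>(A1)\<close>
    and A1_meas: "\<alpha> \<in> borel_measurable \<mu>"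
    and A1_range: "\<forall>s\<in>space \<mu>. 0 < \<alpha> s \<and> \<alpha> s \<le> 1"
    and A1_pos: "(\<integral>s. \<alpha> s \<partial>\<mu>) > 0"
    and A1_strong: "\<forall>s\<in>space \<mu>. strongly_monotone_vf (A s) (\<alpha> s)"
    \<comment> \<open>(A2)\<close>
    and A2_zero: "tzero xs \<in> mean_field \<mu> A xs"
    and A2_Z: "xs \<in> zeros_A2 \<mu> A"
    and A2_phi: "phis \<in> selections \<mu> A 2 xs"
    and A2_int: "is_tbarycenter \<mu> xs phis (tzero xs)"
    \<comment> \<open>(A3)\<close>
    and A3: "\<forall>n. AE \<omega> in P. real_cond_exp P (filtr P \<mu> \<xi> n)
               (\<lambda>\<omega>. tg (phis (\<xi> (Suc n) \<omega>)) (tlog xs (ppa_iter A lam \<xi> x0 n \<omega>))) \<omega> = 0"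
  shows "(\<lambda>n. \<integral>\<^sup>+ \<omega>. ennreal ((dist (ppa_iter A lam \<xi> x0 n \<omega>) xs)^2) \<partial>P) \<longlonglongrightarrow> 0
    \<and> (AE \<omega> in P. (\<lambda>n. (dist (ppa_iter A lam \<xi> x0 n \<omega>) xs)^2) \<longlonglongrightarrow> 0)
    \<and> (\<forall>(chi::real \<Rightarrow> nat) (theta::nat \<Rightarrow> real \<Rightarrow> nat) (\<Lambda>::real) (c::real) (b::real).
         (\<forall>\<epsilon>>0. (\<Sum>n. (lam (n + chi \<epsilon>))^2) < \<epsilon>)
         \<longrightarrow> (\<forall>b'>0. \<forall>k. (\<Sum>n=k..theta k b'. lam n) \<ge> b')
         \<longrightarrow> \<Lambda> > (\<Sum>n. (lam n)^2)
         \<longrightarrow> c > 0 \<longrightarrow> ennreal c > (\<integral>\<^sup>+ s. ennreal ((tnorm (phis s))^2) \<partial>\<mu>)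
         \<longrightarrow> b > 0 \<longrightarrow> b > (dist x0 xs)^2
         \<longrightarrow> (let C = 4 * (b + 2 * \<Lambda> * c) + \<Lambda> * c;
                  D = exp (2 * \<Lambda>) * (b + C) / (2 * (\<integral>s. \<alpha> s \<partial>\<mu>));
                  \<rho> = (\<lambda>\<epsilon>. theta (chi (\<epsilon> / (2 * c))) (2 * D / \<epsilon>));
                  \<rho>' = (\<lambda>l \<epsilon>. \<rho> (l * \<epsilon>))
              in (\<forall>\<epsilon>>0. \<forall>n\<ge>\<rho> \<epsilon>.
                    (\<integral>\<^sup>+ \<omega>. ennreal ((dist (ppa_iter A lam \<xi> x0 n \<omega>) xs)^2) \<partial>P) < ennreal \<epsilon>)
               \<and> (\<forall>l>0. \<forall>\<epsilon>>0.
                    {\<omega>\<in>space P. \<exists>n\<ge>\<rho>' l \<epsilon>. (dist (ppa_iter A lam \<xi> x0 n \<omega>) xs)^2 \<ge> \<epsilon>} \<in> sets P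
                  \<and> emeasure P {\<omega>\<in>space P. \<exists>n\<ge>\<rho>' l \<epsilon>. (dist (ppa_iter A lam \<xi> x0 n \<omega>) xs)^2 \<ge> \<epsilon>}
                      < ennreal l)))"
proof -
  interpret random_ppa P \<mu> A \<alpha> lam \<xi> x0 xs phis
    using assms by (intro random_ppa.intro random_ppa_axioms.intro) auto
  have lim: "(\<lambda>n. \<integral>\<^sup>+ \<omega>. ennreal (sqd n \<omega>) \<partial>P) \<longlonglongrightarrow> 0"
    unfolding nn_integral_sqd using tendsto_ennrealI[OF expectation_tendsto] by simp
  \<comment> \<open>D is a variable with a defining equation here, so that the unfolded
    \<open>let\<close> of the goal matches by reflexivity.\<close>
  have quant: "(\<forall>\<epsilon>>0. \<forall>n\<ge>theta (chi (\<epsilon> / (2 * c))) (2 * D / \<epsilon>).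
        (\<integral>\<^sup>+ \<omega>. ennreal (sqd n \<omega>) \<partial>P) < ennreal \<epsilon>)
      \<and> (\<forall>l>0. \<forall>\<epsilon>>0.
        {\<omega>\<in>space P. \<exists>n\<ge>theta (chi (l * \<epsilon> / (2 * c))) (2 * D / (l * \<epsilon>)). sqd n \<omega> \<ge> \<epsilon>} \<in> sets P
      \<and> emeasure P {\<omega>\<in>space P. \<exists>n\<ge>theta (chi (l * \<epsilon> / (2 * c))) (2 * D / (l * \<epsilon>)). sqd n \<omega> \<ge> \<epsilon>}
          < ennreal l)"
    if chi: "\<forall>\<epsilon>>0. (\<Sum>n. (lam (n + chi \<epsilon>))^2) < \<epsilon>"
      and theta: "\<forall>b'>0. \<forall>k. (\<Sum>n=k..theta k b'. lam n) \<ge> b'"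
      and \<Lambda>: "\<Lambda> > (\<Sum>n. (lam n)^2)" and c: "c > 0"
      "ennreal c > (\<integral>\<^sup>+ s. ennreal ((tnorm (phis s))^2) \<partial>\<mu>)"
      and b: "b > (dist x0 xs)^2"
      and D: "D = exp (2 * \<Lambda>) * (b + (4 * (b + 2 * \<Lambda> * c) + \<Lambda> * c)) / (2 * (\<integral>s. \<alpha> s \<partial>\<mu>))"
    for chi :: "real \<Rightarrow> nat" and theta :: "nat \<Rightarrow> real \<Rightarrow> nat" and \<Lambda> c b D :: real
  proof (intro conjI allI impI)
    have "second_moment < c"
      using c second_moment_nonneg by (simp add: nn_integral_second_moment ennreal_less_iff)
    note rate = rate[OF chi theta \<Lambda> c(1) this b D]
    show "(\<integral>\<^sup>+ \<omega>. ennreal (sqd n \<omega>) \<partial>P) < ennreal \<epsilon>"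
      if "\<epsilon> > 0" "theta (chi (\<epsilon> / (2 * c))) (2 * D / \<epsilon>) \<le> n" for \<epsilon> n
    proof -
      have "0 \<le> second_moment * tail n" using second_moment_nonneg tail_nonneg by simp
      then have "expectation (sqd n) < \<epsilon>" using rate[OF that] by linarith
      then show ?thesis unfolding nn_integral_sqd using expectation_sqd_nonneg by (simp add: ennreal_less_iff)
    qed
    fix l \<epsilon> :: real assume le: "0 < l" "0 < \<epsilon>"
    let ?N = "theta (chi (l * \<epsilon> / (2 * c))) (2 * D / (l * \<epsilon>))"
    show "{\<omega>\<in>space P. \<exists>n\<ge>?N. sqd n \<omega> \<ge> \<epsilon>} \<in> sets P" by measurable
    \<comment> \<open>The maximal inequality divides by \<epsilon>, so a mean below
      \<open>l * \<epsilon>\<close> is required; this is why the almost sure rate evaluates the mean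
      rate at the product.\<close>
    have "expectation (sqd ?N) + second_moment * tail ?N < l * \<epsilon>"
      using le by (intro rate) auto
    from prob_tail_less[OF le(2) this]
    show "emeasure P {\<omega>\<in>space P. \<exists>n\<ge>?N. sqd n \<omega> \<ge> \<epsilon>} < ennreal l"
      by (simp add: emeasure_eq_measure ennreal_less_iff)
  qed
  show ?thesis
    unfolding Let_def
    by (rule conjI[OF lim conjI[OF AE_tendsto]], (rule allI impI)+, rule quant[OF _ _ _ _ _ _ refl]) assumption+
qed

end
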